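(* Let $\Sigma$, given by $f:(u_1,u_2)\times\mathbb{R}\to\mathbb{R}^3$, be a non-planar intrinsic surface of revolution that is also minimal, with twist $\alpha(v)=av$ where $a>0$. Then there are real parameters $A,B>0$ such that, up to a Euclidean isometry of $\mathbb{R}^3$ and a conformal reparametrization, $\Sigma$ is the minimal surface with Weierstrass data $$G(w)=-\frac1A w^{B}\qquad\text{and}\qquad dh=\frac1{2B}w^{2a-1}\,dw ,$$ where $w$ ranges over the universal cover of an annulus $\{r_1<|w|<r_2\}\subset\mathbb{C}$ with $0\le r_1<r_2\le\infty$ (on which the powers of $w$ are defined through a logarithm of $w$).
   Context: Surfaces are three times continuously differentiable immersions $f:(u_1,u_2)\times\mathbb{R}\to\mathbb{R}^3$, with coordinates $(u,v)$. Such a surface is an intrinsic surface of revolution if its first fundamental form is $I_\rho=\rho(u)^2(du^2+dv^2)$ for a positive function $\rho$ of $u$ alone. Let $R^{\theta}=\begin{pmatrix}\cos\theta&-\sin\theta\\ \sin\theta&\cos\theta\end{pmatrix}$. For a $C^1$ function $\alpha:\mathbb{R}\to\mathbb{R}$, the surface has twist $\alpha$ if the matrix of its shape operator with respect to the coordinate basis $(\partial/\partial u,\partial/\partial v)$ is $S=R^{-\alpha(v)}\operatorname{diag}(\lambda_1(u),\lambda_2(u))R^{\alpha(v)}$ for functions $\lambda_1,\lambda_2$ of $u$ alone. Minimal means $\lambda_1+\lambda_2=0$. The minimal surface with Weierstrass data $(G,dh)$ (Gauss map and height differential) is $$w\mapsto \operatorname{Re}\int^w\begin{pmatrix}\frac12\left(\frac1G-G\right)\\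 \frac i2\left(\frac1G+G\right)\\ 1\end{pmatrix}dh .$$ *)

theory Defs
  imports "HOL-Complex_Analysis.Complex_Analysis"
begin

unbundle no fps_syntax

section \<open>Surfaces over a strip\<close>

text \<open>Differentiability class \<open>C\<^sup>k\<close>; only used on open sets.\<close>

primrec C_k_on :: "nat \<Rightarrow> ('a::real_normed_vector \<Rightarrow> 'b::real_normed_vector) \<Rightarrow> 'a set \<Rightarrow> bool" where
  "C_k_on 0 f S = continuous_on S f"
| "C_k_on (Suc k) f S =
     ((\<forall>x\<in>S. f differentiable (at x)) \<and>
      (\<forall>h. C_k_on k (\<lambda>x. frechet_derivative f (at x) h) S))"

text \<open>A point \<open>x\<close> of the parameter plane has coordinates \<open>u = x $ 1\<close>, \<open>v = x $ 2\<close>.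
  The end points of the interval \<open>(u\<^sub>1, u\<^sub>2)\<close> may be infinite.\<close>

definition strip :: "ereal \<Rightarrow> ereal \<Rightarrow> (real^2) set" where
  "strip u1 u2 = {x. u1 < ereal (x $ 1) \<and> ereal (x $ 1) < u2}"

definition C3_immersion_on :: "(real^2) set \<Rightarrow> (real^2 \<Rightarrow> real^3) \<Rightarrow> bool" where
  "C3_immersion_on D f \<longleftrightarrow>
     C_k_on 3 f D \<and> (\<forall>x\<in>D. inj (frechet_derivative f (at x)))"

definition first_fundamental_form ::
    "(real^2 \<Rightarrow> real^3) \<Rightarrow> real^2 \<Rightarrow> real^2 \<Rightarrow> real^2 \<Rightarrow> real" where
  "first_fundamental_form f x X Y =
     frechet_derivative f (at x) X \<bullet> frechet_derivative f (at x) Y"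

definition unit_normal :: "(real^2 \<Rightarrow> real^3) \<Rightarrow> real^2 \<Rightarrow> real^3" where
  "unit_normal f x =
     (let n = cross3 (frechet_derivative f (at x) (axis 1 1))
                     (frechet_derivative f (at x) (axis 2 1))
      in n /\<^sub>R norm n)"

text \<open>The shape operator \<open>S = - df\<^sup>-\<^sup>1 \<circ> dN\<close>, acting on coordinate vectors. It is well defined
  for an immersion, and its matrix in the coordinate basis \<open>(\<partial>/\<partial>u, \<partial>/\<partial>v)\<close> is
  \<open>matrix (shape_operator f x)\<close>.\<close>

definition shape_operator :: "(real^2 \<Rightarrow> real^3) \<Rightarrow> real^2 \<Rightarrow> real^2 \<Rightarrow> real^2" where
  "shape_operator f x X =
     (THE Y. frechet_derivative f (at x) Y
             = - frechet_derivative (unit_normal f) (at x) X)"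

text \<open>\<open>X \<bullet> Y\<close> is the form \<open>du\<^sup>2 + dv\<^sup>2\<close> evaluated at \<open>(X, Y)\<close>.\<close>

definition intrinsic_surface_of_revolution ::
    "ereal \<Rightarrow> ereal \<Rightarrow> (real^2 \<Rightarrow> real^3) \<Rightarrow> bool" where
  "intrinsic_surface_of_revolution u1 u2 f \<longleftrightarrow>
     C3_immersion_on (strip u1 u2) f \<and>
     (\<exists>\<rho>::real \<Rightarrow> real.
        (\<forall>u. u1 < ereal u \<and> ereal u < u2 \<longrightarrow> \<rho> u > 0) \<and>
        (\<forall>x\<in>strip u1 u2. \<forall>X Y.
           first_fundamental_form f x X Y = (\<rho> (x $ 1))\<^sup>2 * (X \<bullet> Y)))"

definition rot2 :: "real \<Rightarrow> real^2^2" where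
  "rot2 \<theta> = vector [vector [cos \<theta>, - sin \<theta>], vector [sin \<theta>, cos \<theta>]]"

definition diag2 :: "real \<Rightarrow> real \<Rightarrow> real^2^2" where
  "diag2 p q = vector [vector [p, 0], vector [0, q]]"

definition has_twist ::
    "ereal \<Rightarrow> ereal \<Rightarrow> (real^2 \<Rightarrow> real^3) \<Rightarrow> (real \<Rightarrow> real)
      \<Rightarrow> (real \<Rightarrow> real) \<Rightarrow> (real \<Rightarrow> real) \<Rightarrow> bool" where
  "has_twist u1 u2 f \<alpha> l1 l2 \<longleftrightarrow>
     C_k_on 1 \<alpha> UNIV \<and>
     (\<forall>x\<in>strip u1 u2.
        matrix (shape_operator f x) =
          rot2 (- \<alpha> (x $ 2)) ** diag2 (l1 (x $ 1)) (l2 (x $ 1)) ** rot2 (\<alpha> (x $ 2)))"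


section \<open>Weierstrass representation\<close>

text \<open>Weierstrass data in a complex coordinate \<open>\<zeta>\<close>: the Gauss map \<open>G\<close> and the height
  differential \<open>dh = h(\<zeta>) d\<zeta>\<close>.\<close>

definition weierstrass_integrand ::
    "(complex \<Rightarrow> complex) \<Rightarrow> (complex \<Rightarrow> complex) \<Rightarrow> complex \<Rightarrow> complex^3" where
  "weierstrass_integrand G h \<zeta> =
     vector [1 / 2 * (1 / G \<zeta> - G \<zeta>) * h \<zeta>,
             \<i> / 2 * (1 / G \<zeta> + G \<zeta>) * h \<zeta>,
             h \<zeta>]"

text \<open>\<open>X\<close> is the real part of the path integral of the integrand from some base point of \<open>D\<close>,
  and the integral exists and does not depend on the path in \<open>D\<close>.\<close>

definition weierstrass_surface_on ::
    "complex set \<Rightarrow> (complex \<Rightarrow> complex) \<Rightarrow> (complex \<Rightarrow> complex)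
      \<Rightarrow> (complex \<Rightarrow> real^3) \<Rightarrow> bool" where
  "weierstrass_surface_on D G h X \<longleftrightarrow>
     (\<exists>\<zeta>0\<in>D. \<forall>\<gamma>. valid_path \<gamma> \<and> path_image \<gamma> \<subseteq> D \<and> pathstart \<gamma> = \<zeta>0 \<longrightarrow>
        (\<forall>k. (\<lambda>\<zeta>. weierstrass_integrand G h \<zeta> $ k) contour_integrable_on \<gamma> \<and>
             X (pathfinish \<gamma>) $ k
               = Re (contour_integral \<gamma> (\<lambda>\<zeta>. weierstrass_integrand G h \<zeta> $ k))))"

definition annulus0 :: "real \<Rightarrow> ereal \<Rightarrow> complex set" where
  "annulus0 r1 r2 = {w. r1 < norm w \<and> ereal (norm w) < r2}"

text \<open>For \<open>r1 \<ge> 0\<close>, the universal cover of the annulus, with covering map \<^const>\<open>exp\<close>: its points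
  are the logarithms \<open>\<zeta>\<close> of the points \<open>w\<close> of the annulus.\<close>

definition annulus_cover :: "real \<Rightarrow> ereal \<Rightarrow> complex set" where
  "annulus_cover r1 r2 = exp -` annulus0 r1 r2"

lemma covering_space_restrict:
  assumes cov: "covering_space C p S" and T: "T \<subseteq> S"
  shows "covering_space (C \<inter> p -` T) p T"
proof
  show "continuous_on (C \<inter> p -` T) p"
    using covering_space_imp_continuous[OF cov] continuous_on_subset by blast
  show "p ` (C \<inter> p -` T) = T"
    using covering_space_imp_surjective[OF cov] T by auto
next
  fix x assume x: "x \<in> T"
  then obtain U \<V> where U: "x \<in> U" "openin (top_of_set S) U"
    and V: "\<Union>\<V> = C \<inter> p -` U" "\<And>u. u \<in> \<V> \<Longrightarrow> openin (top_of_set C) u" "pairwise disjnt \<V>"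
      "\<And>u. u \<in> \<V> \<Longrightarrow> \<exists>q. homeomorphism u U p q"
  proof -
    have "x \<in> S" using x T by blast
    then show ?thesis
      using cov that unfolding covering_space_def by (elim conjE ballE[of _ _ x] exE) simp_all
  qed
  define \<W> where "\<W> = (\<lambda>u. u \<inter> p -` T) ` \<V>"
  have "\<Union>\<W> = (C \<inter> p -` T) \<inter> p -` (U \<inter> T)"
    using V(1) unfolding \<W>_def by auto
  moreover have "openin (top_of_set (C \<inter> p -` T)) w" if "w \<in> \<W>" for w
  proof -
    from that obtain u where u: "u \<in> \<V>" "w = u \<inter> p -` T" unfolding \<W>_def by auto
    obtain B where B: "open B" "u = C \<inter> B" using V(2)[OF u(1)] by (auto simp: openin_open)
    then have "w = (C \<inter> p -` T) \<inter> B" using u by auto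
    then show ?thesis using B(1) by (auto simp: openin_open)
  qed
  moreover have "pairwise disjnt \<W>"
    using V(3) unfolding \<W>_def pairwise_def disjnt_def by blast
  moreover have "\<exists>q. homeomorphism w (U \<inter> T) p q" if "w \<in> \<W>" for w
  proof -
    from that obtain u where u: "u \<in> \<V>" "w = u \<inter> p -` T" unfolding \<W>_def by auto
    obtain q where q: "homeomorphism u U p q" using V(4)[OF u(1)] by auto
    have "homeomorphism w (U \<inter> T) p q"
    proof (rule homeomorphism_of_subsets[OF q])
      show "w \<subseteq> u" "U \<inter> T \<subseteq> U" using u by auto
      show "p ` w = U \<inter> T"
        using homeomorphism_image1[OF q] u(2) by auto
    qed
    then show ?thesis by blast
  qed
  moreover have "x \<in> U \<inter> T" using x U by auto
  moreover have "openin (top_of_set T) (U \<inter> T)"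
    using U(2) T by (auto simp: openin_open)
  ultimately show "\<exists>Ta. x \<in> Ta \<and> openin (top_of_set T) Ta \<and>
      (\<exists>v. \<Union>v = (C \<inter> p -` T) \<inter> p -` Ta \<and>
           (\<forall>u\<in>v. openin (top_of_set (C \<inter> p -` T)) u) \<and> pairwise disjnt v \<and>
           (\<forall>u\<in>v. \<exists>q. homeomorphism u Ta p q))"
    by (intro exI[of _ "U \<inter> T"] exI[of _ \<W>] conjI ballI) simp_all
qed

lemma annulus_cover_universal:
  assumes "0 \<le> r1"
  shows "covering_space (annulus_cover r1 r2) exp (annulus0 r1 r2)"
    and "simply_connected (annulus_cover r1 r2)"
proof -
  have "annulus0 r1 r2 \<subseteq> - {0}"
    using assms by (auto simp: annulus0_def)
  from covering_space_restrict[OF covering_space_exp_punctured_plane this]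
  show "covering_space (annulus_cover r1 r2) exp (annulus0 r1 r2)"
    by (simp add: annulus_cover_def)
  have "convex {x::real. r1 < exp x \<and> ereal (exp x) < r2}"
    unfolding is_interval_convex_1[symmetric] is_interval_1
  proof (intro ballI allI impI)
    fix p q x :: real
    assume p: "p \<in> {x. r1 < exp x \<and> ereal (exp x) < r2}"
      and q: "q \<in> {x. r1 < exp x \<and> ereal (exp x) < r2}" and x: "p \<le> x \<and> x \<le> q"
    have "exp p \<le> exp x" "ereal (exp x) \<le> ereal (exp q)" using x by simp_all
    moreover have "r1 < exp p" "ereal (exp q) < r2" using p q by simp_all
    ultimately have "r1 < exp x" "ereal (exp x) < r2"
      by (meson less_le_trans le_less_trans)+
    then show "x \<in> {x. r1 < exp x \<and> ereal (exp x) < r2}" by simp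
  qed
  then have "convex (Re -` {x::real. r1 < exp x \<and> ereal (exp x) < r2})"
    by (intro convex_linear_vimage) (auto intro: bounded_linear.linear bounded_linear_Re)
  moreover have "annulus_cover r1 r2 = Re -` {x::real. r1 < exp x \<and> ereal (exp x) < r2}"
    by (auto simp: annulus_cover_def annulus0_def)
  ultimately show "simply_connected (annulus_cover r1 r2)"
    by (simp add: convex_imp_simply_connected)
qed

text \<open>The power \<open>w\<^sup>s\<close> at the point of the universal cover given by the logarithm \<open>\<zeta>\<close> of \<open>w\<close>.\<close>

definition cover_pow :: "real \<Rightarrow> complex \<Rightarrow> complex" where
  "cover_pow s \<zeta> = exp (of_real s * \<zeta>)"

text \<open>\<open>G(w) = - w\<^sup>B / A\<close> and \<open>dh = w\<^sup>2\<^sup>a\<^sup>-\<^sup>1 dw / (2 B)\<close> on the universal cover;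
  the last factor in \<open>twist_height\<close> comes from \<open>dw = exp \<zeta> d\<zeta>\<close>.\<close>

definition twist_gauss :: "real \<Rightarrow> real \<Rightarrow> complex \<Rightarrow> complex" where
  "twist_gauss A B \<zeta> = - (1 / of_real A) * cover_pow B \<zeta>"

definition twist_height :: "real \<Rightarrow> real \<Rightarrow> complex \<Rightarrow> complex" where
  "twist_height a B \<zeta> = 1 / (2 * of_real B) * cover_pow (2 * a - 1) \<zeta> * exp \<zeta>"


section \<open>Equivalence of surfaces\<close>

definition euclidean_isometry :: "(real^3 \<Rightarrow> real^3) \<Rightarrow> bool" where
  "euclidean_isometry T \<longleftrightarrow> (\<forall>x y. dist (T x) (T y) = dist x y)"

definition conformal_bijection :: "complex set \<Rightarrow> complex set \<Rightarrow> (complex \<Rightarrow> complex) \<Rightarrow> bool" where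
  "conformal_bijection D E \<phi> \<longleftrightarrow> \<phi> holomorphic_on D \<and> bij_betw \<phi> D E"

definition to_complex :: "real^2 \<Rightarrow> complex" where
  "to_complex x = Complex (x $ 1) (x $ 2)"

end

theory Submission
  imports Defs
begin

text \<open>
  Write \<open>z = u + \<i> v\<close> and let a dot between vectors of \<open>\<complex>\<^sup>3\<close> denote the complex bilinear product. Conformal
  coordinates and zero mean curvature make \<open>f\<close> harmonic, so \<open>\<Phi> = f\<^sub>u - \<i> f\<^sub>v\<close> is a holomorphic null
  curve, \<open>\<Phi> \<cdot> \<Phi> = 0\<close>, with \<open>\<bar>\<Phi>\<bar>\<^sup>2 = 2 \<rho>\<^sup>2\<close>, and \<open>f\<close> is the real part of a primitive of \<open>\<Phi>\<close>. The
  derivative \<open>\<Phi>'\<close> is a multiple of \<open>\<Phi>\<close> plus \<open>L - \<i> M\<close> times the unit normal, where \<open>L\<close> and \<open>M\<close> are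
  coefficients of the second fundamental form, so \<open>\<Phi>' \<cdot> \<Phi>' = (L - \<i> M)\<^sup>2\<close>. The
  twist says that this is \<open>exp (4 a v \<i>)\<close> times a nonnegative function of \<open>u\<close>
  (\<open>twisted_minimal_surface_derivatives\<close>).

  Put \<open>P = exp (- 2 a z) \<Phi>\<close>. Then \<open>P' \<cdot> P'\<close> is holomorphic and real, hence a constant \<open>C \<ge> 0\<close>. If
  \<open>C = 0\<close>, the shape operator vanishes and the surface is planar. If \<open>C > 0\<close>, the curve \<open>P\<close> is null,
  has the constant \<open>P' \<cdot> P' = C\<close>, and a Hermitian length that depends on \<open>u\<close> alone. These properties
  determine \<open>P\<close> up to a real orthogonal map and two positive parameters besides \<open>C\<close>
  (\<open>null_curve_exponential_form\<close>). Indeed, independence of \<open>v\<close> makes all Hermitian pairings of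
  derivatives of \<open>P\<close> real (\<open>herm_derivative_shift\<close>); by a Gram determinant \<open>P'' \<cdot> P''\<close> is then real
  and negative, hence a constant \<open>- C k\<^sup>2\<close>; and comparing pairings with the basis \<open>P\<close>, \<open>P'\<close>, \<open>P''\<close>
  yields \<open>P''' = k\<^sup>2 P'\<close>. So
  \<open>P = (sqrt C / k) e3 + v exp (k z) (e1 - \<i> e2) - C / (4 k\<^sup>2 v) exp (- k z) (e1 + \<i> e2)\<close> with an
  orthonormal frame \<open>e1\<close>, \<open>e2\<close>, \<open>e3\<close>. The integrability conditions of Gauss and Codazzi and the
  uniqueness theorem for surfaces are thereby replaced by complex analysis of one curve.

  Up to a translation of \<open>z\<close>, this \<open>\<Phi> = exp (2 a z) P\<close> is the Weierstrass integrand of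
  \<open>G = - w\<^sup>B / A\<close>, \<open>dh = w\<^sup>2\<^sup>a\<^sup>-\<^sup>1 dw / (2 B)\<close> for \<open>w = exp z\<close> and \<open>B = k\<close>, expressed in the frame
  (\<open>exponential_curve_weierstrass\<close>). The orthogonal map with columns \<open>e1\<close>, \<open>e2\<close>, \<open>e3\<close> and the constant
  of integration make up the isometry.
\<close>


section \<open>Mixed second derivatives\<close>

text \<open>The second difference over a parallelogram with sides \<open>t h\<close> and \<open>t k\<close> is an increment in the
  direction \<open>h\<close> of the first difference in the direction \<open>k\<close>, so the mean value theorem applied
  twice turns it into \<open>t\<^sup>2\<close> times a mixed second derivative. Exchanging \<open>h\<close> and \<open>k\<close> leaves the second
  difference unchanged; this is what forces the two mixed derivatives to agree.\<close>

lemma second_difference_mean_value: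
  fixes g :: "'a::real_normed_vector \<Rightarrow> real" and Dh D2 :: "'a \<Rightarrow> real"
  assumes t: "0 < t"
    and mem: "\<And>s r. 0 \<le> s \<Longrightarrow> s \<le> t \<Longrightarrow> 0 \<le> r \<Longrightarrow> r \<le> t \<Longrightarrow> x + s *\<^sub>R h + r *\<^sub>R k \<in> S"
    and g: "\<And>y. y \<in> S \<Longrightarrow> \<exists>g'. (g has_derivative g') (at y) \<and> g' h = Dh y"
    and Dh: "\<And>y. y \<in> S \<Longrightarrow> \<exists>g'. (Dh has_derivative g') (at y) \<and> g' k = D2 y"
  shows "\<exists>s r. 0 < s \<and> s < t \<and> 0 < r \<and> r < t \<and>
    g (x + t *\<^sub>R h + t *\<^sub>R k) - g (x + t *\<^sub>R h) - g (x + t *\<^sub>R k) + g x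
      = t\<^sup>2 * D2 (x + s *\<^sub>R h + r *\<^sub>R k)"
proof -
  have gd: "((\<lambda>s. g (x + s *\<^sub>R h + r *\<^sub>R k)) has_real_derivative Dh (x + s *\<^sub>R h + r *\<^sub>R k)) (at s)"
    if sr: "0 \<le> s" "s \<le> t" "0 \<le> r" "r \<le> t" for s r
  proof -
    obtain g' where g': "(g has_derivative g') (at (x + s *\<^sub>R h + r *\<^sub>R k))"
      "g' h = Dh (x + s *\<^sub>R h + r *\<^sub>R k)"
      using g mem[OF sr] by blast
    have "((\<lambda>s. x + s *\<^sub>R h + r *\<^sub>R k) has_derivative (\<lambda>d. d *\<^sub>R h)) (at s)"
      by (auto intro!: derivative_eq_intros)
    from has_derivative_compose[OF this g'(1)]
    have "((\<lambda>s. g (x + s *\<^sub>R h + r *\<^sub>R k)) has_derivative (\<lambda>d. g' (d *\<^sub>R h))) (at s)" .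
    moreover have "g' (d *\<^sub>R h) = Dh (x + s *\<^sub>R h + r *\<^sub>R k) * d" for d
      using g' has_derivative_linear[OF g'(1)] by (simp add: linear_cmul)
    ultimately show ?thesis by (simp add: has_field_derivative_def)
  qed
  have dd: "((\<lambda>r. Dh (x + s *\<^sub>R h + r *\<^sub>R k)) has_real_derivative D2 (x + s *\<^sub>R h + r *\<^sub>R k)) (at r)"
    if sr: "0 \<le> s" "s \<le> t" "0 \<le> r" "r \<le> t" for s r
  proof -
    obtain g' where g': "(Dh has_derivative g') (at (x + s *\<^sub>R h + r *\<^sub>R k))"
      "g' k = D2 (x + s *\<^sub>R h + r *\<^sub>R k)"
      using Dh mem[OF sr] by blast
    have "((\<lambda>r. x + s *\<^sub>R h + r *\<^sub>R k) has_derivative (\<lambda>d. d *\<^sub>R k)) (at r)"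
      by (auto intro!: derivative_eq_intros)
    from has_derivative_compose[OF this g'(1)]
    have "((\<lambda>r. Dh (x + s *\<^sub>R h + r *\<^sub>R k)) has_derivative (\<lambda>d. g' (d *\<^sub>R k))) (at r)" .
    moreover have "g' (d *\<^sub>R k) = D2 (x + s *\<^sub>R h + r *\<^sub>R k) * d" for d
      using g' has_derivative_linear[OF g'(1)] by (simp add: linear_cmul)
    ultimately show ?thesis by (simp add: has_field_derivative_def)
  qed
  have "\<exists>s. 0 < s \<and> s < t \<and>
      (g (x + t *\<^sub>R h + t *\<^sub>R k) - g (x + t *\<^sub>R h + 0 *\<^sub>R k))
       - (g (x + 0 *\<^sub>R h + t *\<^sub>R k) - g (x + 0 *\<^sub>R h + 0 *\<^sub>R k))
      = (t - 0) * (Dh (x + s *\<^sub>R h + t *\<^sub>R k) - Dh (x + s *\<^sub>R h + 0 *\<^sub>R k))"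
  proof (rule MVT2[OF t, of "\<lambda>s. g (x + s *\<^sub>R h + t *\<^sub>R k) - g (x + s *\<^sub>R h + 0 *\<^sub>R k)"])
    fix s assume "0 \<le> s" "s \<le> t"
    then show "((\<lambda>s. g (x + s *\<^sub>R h + t *\<^sub>R k) - g (x + s *\<^sub>R h + 0 *\<^sub>R k)) has_real_derivative
        Dh (x + s *\<^sub>R h + t *\<^sub>R k) - Dh (x + s *\<^sub>R h + 0 *\<^sub>R k)) (at s)"
      using gd[of s t] gd[of s 0] t by (intro DERIV_diff) auto
  qed
  then obtain s where s: "0 < s" "s < t"
    and e1: "g (x + t *\<^sub>R h + t *\<^sub>R k) - g (x + t *\<^sub>R h) - g (x + t *\<^sub>R k) + g x
      = t * (Dh (x + s *\<^sub>R h + t *\<^sub>R k) - Dh (x + s *\<^sub>R h + 0 *\<^sub>R k))"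
    by auto
  have "\<exists>r. 0 < r \<and> r < t \<and> Dh (x + s *\<^sub>R h + t *\<^sub>R k) - Dh (x + s *\<^sub>R h + 0 *\<^sub>R k)
      = (t - 0) * D2 (x + s *\<^sub>R h + r *\<^sub>R k)"
    by (rule MVT2[OF t, of "\<lambda>r. Dh (x + s *\<^sub>R h + r *\<^sub>R k)"]) (use dd[of s] s in auto)
  with s e1 show ?thesis by (auto simp: power2_eq_square)
qed

text \<open>Evaluating the same second difference in both orders gives equal values of the two mixed
  derivatives at two points near \<open>x\<close>; continuity moves both points to \<open>x\<close>. The derivatives enter as
  given functions, so that the rule applies componentwise to vector-valued maps.\<close>

lemma mixed_derivatives_commute:
  fixes g :: "'a::real_normed_vector \<Rightarrow> real"
  assumes S: "open S" "x \<in> S"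
    and g: "\<And>y. y \<in> S \<Longrightarrow> \<exists>g'. (g has_derivative g') (at y) \<and> g' h = Dh y \<and> g' k = Dk y"
    and Dh: "\<And>y. y \<in> S \<Longrightarrow> \<exists>g'. (Dh has_derivative g') (at y) \<and> g' k = Dhk y"
    and Dk: "\<And>y. y \<in> S \<Longrightarrow> \<exists>g'. (Dk has_derivative g') (at y) \<and> g' h = Dkh y"
    and cont: "continuous_on S Dhk" "continuous_on S Dkh"
  shows "Dhk x = Dkh x"
proof (rule ccontr)
  assume ne: "Dhk x \<noteq> Dkh x"
  define e where "e = \<bar>Dhk x - Dkh x\<bar> / 2"
  have e: "e > 0" using ne by (simp add: e_def)
  have "continuous (at x) Dhk" "continuous (at x) Dkh"
    using S cont continuous_on_eq_continuous_at by blast+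
  then obtain d1 d2 where d1: "d1 > 0" "\<And>y. dist y x < d1 \<Longrightarrow> dist (Dhk y) (Dhk x) < e"
    and d2: "d2 > 0" "\<And>y. dist y x < d2 \<Longrightarrow> dist (Dkh y) (Dkh x) < e"
    using e unfolding continuous_at_eps_delta by metis
  obtain d3 where d3: "d3 > 0" "ball x d3 \<subseteq> S" using S openE by blast
  define d where "d = min d1 (min d2 d3)"
  define t where "t = d / (2 * (norm h + norm k + 1))"
  have np: "norm h + norm k + 1 > 0"
    using norm_ge_zero[of h] norm_ge_zero[of k] by linarith
  have d: "d > 0" using d1 d2 d3 by (simp add: d_def)
  have t: "t > 0" using d np by (simp add: t_def)
  have near: "dist (x + s *\<^sub>R h + r *\<^sub>R k) x < d" if "0 \<le> s" "s \<le> t" "0 \<le> r" "r \<le> t" for s r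
  proof -
    have "dist (x + s *\<^sub>R h + r *\<^sub>R k) x = norm (s *\<^sub>R h + r *\<^sub>R k)"
      by (simp add: dist_norm algebra_simps)
    also have "\<dots> \<le> s * norm h + r * norm k"
      using norm_triangle_ineq[of "s *\<^sub>R h" "r *\<^sub>R k"] that by simp
    also have "\<dots> \<le> t * norm h + t * norm k"
      using that by (intro add_mono mult_right_mono) auto
    also have "\<dots> < t * (2 * (norm h + norm k + 1))"
      using t np by (simp add: algebra_simps) (smt (verit) mult_nonneg_nonneg norm_ge_zero)
    also have "\<dots> = d" using np by (simp add: t_def)
    finally show ?thesis .
  qed
  have mem: "x + s *\<^sub>R h + r *\<^sub>R k \<in> S" "x + r *\<^sub>R k + s *\<^sub>R h \<in> S"
    if "0 \<le> s" "s \<le> t" "0 \<le> r" "r \<le> t" for s r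
  proof -
    have "x + s *\<^sub>R h + r *\<^sub>R k \<in> ball x d3"
      using near[OF that] by (simp add: d_def dist_commute)
    then show "x + s *\<^sub>R h + r *\<^sub>R k \<in> S" using d3 by blast
    then show "x + r *\<^sub>R k + s *\<^sub>R h \<in> S" by (simp add: algebra_simps)
  qed
  obtain s r where sr: "0 < s" "s < t" "0 < r" "r < t" and
    E1: "g (x + t *\<^sub>R h + t *\<^sub>R k) - g (x + t *\<^sub>R h) - g (x + t *\<^sub>R k) + g x
      = t\<^sup>2 * Dhk (x + s *\<^sub>R h + r *\<^sub>R k)"
    using second_difference_mean_value[OF t mem(1), where g=g and Dh=Dh and ?D2.0=Dhk] g Dh by blast
  obtain r' s' where sr': "0 < r'" "r' < t" "0 < s'" "s' < t" and
    E2: "g (x + t *\<^sub>R k + t *\<^sub>R h) - g (x + t *\<^sub>R k) - g (x + t *\<^sub>R h) + g x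
      = t\<^sup>2 * Dkh (x + r' *\<^sub>R k + s' *\<^sub>R h)"
    using second_difference_mean_value[OF t mem(2), where g=g and Dh=Dk and ?D2.0=Dkh] g Dk by blast
  have "t\<^sup>2 * Dhk (x + s *\<^sub>R h + r *\<^sub>R k) = t\<^sup>2 * Dkh (x + s' *\<^sub>R h + r' *\<^sub>R k)"
    using E1 E2 by (simp add: algebra_simps)
  then have "Dhk (x + s *\<^sub>R h + r *\<^sub>R k) = Dkh (x + s' *\<^sub>R h + r' *\<^sub>R k)"
    using t by simp
  moreover have "dist (Dhk (x + s *\<^sub>R h + r *\<^sub>R k)) (Dhk x) < e"
    using near[of s r] sr by (intro d1(2)) (simp add: d_def)
  moreover have "dist (Dkh (x + s' *\<^sub>R h + r' *\<^sub>R k)) (Dkh x) < e"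
    using near[of s' r'] sr' by (intro d2(2)) (simp add: d_def)
  ultimately show False by (simp add: e_def dist_real_def) (smt (verit) field_sum_of_halves)
qed


section \<open>Conformal frames in three-space\<close>

lemma orthonormal_expansion:
  fixes e1 e2 e3 w :: "real^3"
  assumes "norm e1 = 1" "norm e2 = 1" "norm e3 = 1" "e1 \<bullet> e2 = 0" "e1 \<bullet> e3 = 0" "e2 \<bullet> e3 = 0"
  shows "w = (e1 \<bullet> w) *\<^sub>R e1 + (e2 \<bullet> w) *\<^sub>R e2 + (e3 \<bullet> w) *\<^sub>R e3"
proof -
  define Q where "Q = (vector [e1, e2, e3] :: real^3^3)"
  have "orthogonal_matrix Q"
    unfolding orthogonal_matrix_orthonormal_rows
    using assms by (auto simp: Q_def forall_3 row_def orthogonal_def vec_lambda_eta vector_3 inner_commute)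
  then have "transpose Q *v (Q *v w) = w"
    by (simp add: orthogonal_matrix matrix_vector_mul_assoc)
  moreover have "transpose Q *v (Q *v w) = (e1 \<bullet> w) *\<^sub>R e1 + (e2 \<bullet> w) *\<^sub>R e2 + (e3 \<bullet> w) *\<^sub>R e3"
    by (simp add: vec_eq_iff Q_def matrix_vector_mult_def transpose_def sum_3 vector_3 inner_vec_def algebra_simps)
  ultimately show ?thesis by (simp only:)
qed

text \<open>In conformal coordinates the tangent vectors \<open>a\<close>, \<open>b\<close> are orthogonal of equal length, but not unit
  vectors; \<open>r\<close> is their common squared length.\<close>

lemma conformal_frame_expansion:
  fixes a b n w :: "real^3"
  assumes "a \<bullet> a = r" "b \<bullet> b = r" "a \<bullet> b = 0" "r > 0" "n \<bullet> n = 1" "n \<bullet> a = 0" "n \<bullet> b = 0"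
  shows "w = (w \<bullet> a / r) *\<^sub>R a + (w \<bullet> b / r) *\<^sub>R b + (w \<bullet> n) *\<^sub>R n"
proof -
  have s: "sqrt r > 0" "norm a = sqrt r" "norm b = sqrt r" using assms by (simp_all add: norm_eq_sqrt_inner)
  have "w = ((a /\<^sub>R sqrt r) \<bullet> w) *\<^sub>R (a /\<^sub>R sqrt r) + ((b /\<^sub>R sqrt r) \<bullet> w) *\<^sub>R (b /\<^sub>R sqrt r) + (n \<bullet> w) *\<^sub>R n"
    by (rule orthonormal_expansion) (use assms s in \<open>simp_all add: norm_eq_1 inner_commute\<close>)
  moreover have "((c /\<^sub>R sqrt r) \<bullet> w) *\<^sub>R (c /\<^sub>R sqrt r) = (w \<bullet> c / r) *\<^sub>R c" for c :: "real^3"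
  proof -
    have "inverse (sqrt r) * (c \<bullet> w) * inverse (sqrt r) = w \<bullet> c / r"
      using assms(4) by (simp add: field_simps inner_commute)
    then show ?thesis by (simp add: mult_ac)
  qed
  ultimately show ?thesis
    by (simp only: inner_commute[of n w])
qed

text \<open>The equations for \<open>auu\<close>, \<open>auv\<close>, \<open>avv\<close> against \<open>a\<close> and \<open>b\<close> are the derivatives of the conformality
  relations. They say that the tangential parts of \<open>auu\<close> and \<open>auv\<close> have equal length and are
  orthogonal, and that \<open>auu + avv\<close> has no tangential part. Hence only the normal components \<open>L\<close>, \<open>M\<close>
  survive in the combinations below, which are the real part and, up to the factor \<open>-2\<close>, the imaginary part of
  \<open>(L - \<i> M)\<^sup>2\<close>; and zero mean curvature makes the position vector harmonic.\<close>

lemma minimal_second_derivatives: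
  fixes a b n auu auv avv :: "real^3"
  assumes fr: "a \<bullet> a = r" "b \<bullet> b = r" "a \<bullet> b = 0" "r > 0" "n \<bullet> n = 1" "n \<bullet> a = 0" "n \<bullet> b = 0"
    and t: "auu \<bullet> a = auv \<bullet> b" "auv \<bullet> a = avv \<bullet> b" "auu \<bullet> b + auv \<bullet> a = 0" "auv \<bullet> b + avv \<bullet> a = 0"
    and nn: "auu \<bullet> n = L" "auv \<bullet> n = M" "avv \<bullet> n = - L"
  shows "avv = - auu" "auu \<bullet> auu - auv \<bullet> auv = L\<^sup>2 - M\<^sup>2" "auu \<bullet> auv = L * M"
proof -
  note ex = conformal_frame_expansion[OF fr]
  have inn: "v \<bullet> w = (v \<bullet> a) * (w \<bullet> a) / r + (v \<bullet> b) * (w \<bullet> b) / r + (v \<bullet> n) * (w \<bullet> n)" for v w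
  proof -
    have "v \<bullet> w = v \<bullet> ((w \<bullet> a / r) *\<^sub>R a + (w \<bullet> b / r) *\<^sub>R b + (w \<bullet> n) *\<^sub>R n)"
      by (rule arg_cong[where f = "\<lambda>t. v \<bullet> t", OF ex])
    then show ?thesis by (simp only: inner_add_right inner_scaleR_right times_divide_eq_left times_divide_eq_right mult.commute)
  qed
  have "avv = (- (auu \<bullet> a) / r) *\<^sub>R a + (- (auu \<bullet> b) / r) *\<^sub>R b + (- (auu \<bullet> n)) *\<^sub>R n"
  proof -
    have "avv \<bullet> a = - (auu \<bullet> a)" "avv \<bullet> b = - (auu \<bullet> b)" "avv \<bullet> n = - (auu \<bullet> n)"
      using t nn by simp_all
    then show ?thesis by (subst ex[of avv]) simp
  qed
  also have "\<dots> = - ((auu \<bullet> a / r) *\<^sub>R a + (auu \<bullet> b / r) *\<^sub>R b + (auu \<bullet> n) *\<^sub>R n)" by simp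
  also have "\<dots> = - auu" by (simp only: ex[of auu, symmetric])
  finally show "avv = - auu" .
  have m: "auv \<bullet> a = - (auu \<bullet> b)" "auv \<bullet> b = auu \<bullet> a" using t by simp_all
  show "auu \<bullet> auu - auv \<bullet> auv = L\<^sup>2 - M\<^sup>2"
    unfolding inn[of auu auu] inn[of auv auv] m nn by (simp add: power2_eq_square)
  show "auu \<bullet> auv = L * M"
    unfolding inn[of auu auv] m nn by simp
qed

text \<open>The plane through \<open>p0\<close> orthogonal to \<open>n\<close> is the affine hull of \<open>p0\<close>, \<open>p0 + a\<close> and \<open>p0 + b\<close>.\<close>

lemma coplanar_in_plane:
  fixes a b n p0 :: "real^3"
  assumes fr: "a \<bullet> a = r" "b \<bullet> b = r" "a \<bullet> b = 0" "r > 0" "n \<bullet> n = 1" "n \<bullet> a = 0" "n \<bullet> b = 0"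
    and pl: "\<And>p. p \<in> A \<Longrightarrow> p \<bullet> n = p0 \<bullet> n"
  shows "coplanar A"
proof -
  have "p \<in> affine hull {p0, p0 + a, p0 + b}" if "p \<in> A" for p
  proof -
    define s t where "s = (p - p0) \<bullet> a / r" and "t = (p - p0) \<bullet> b / r"
    have "p - p0 = s *\<^sub>R a + t *\<^sub>R b + ((p - p0) \<bullet> n) *\<^sub>R n"
      unfolding s_def t_def by (rule conformal_frame_expansion[OF fr])
    also have "(p - p0) \<bullet> n = 0" using pl[OF that] by (simp add: inner_diff_left)
    finally have "p = (1 - s - t) *\<^sub>R p0 + s *\<^sub>R (p0 + a) + t *\<^sub>R (p0 + b)"
      by (simp add: algebra_simps)
    then show ?thesis unfolding affine_hull_3 by fastforce
  qed
  then show ?thesis unfolding coplanar_def by blast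
qed


section \<open>Partial derivatives\<close>

definition partial :: "2 \<Rightarrow> (real^2 \<Rightarrow> 'b::real_normed_vector) \<Rightarrow> real^2 \<Rightarrow> 'b" where
  "partial i f x = frechet_derivative f (at x) (axis i 1)"

lemma C_k_on_partial:
  assumes "C_k_on (Suc k) f S"
  shows "C_k_on k (partial i f) S" and "x \<in> S \<Longrightarrow> f differentiable (at x)"
  using assms by (auto simp: partial_def[abs_def])

lemma frechet_derivative_partial:
  assumes "f differentiable (at x)"
  shows "frechet_derivative f (at x) h = (h $ 1) *\<^sub>R partial 1 f x + (h $ 2) *\<^sub>R partial 2 f x"
proof -
  have l: "linear (frechet_derivative f (at x))" using assms by (rule linear_frechet_derivative)
  have h: "h = (h $ 1) *\<^sub>R axis 1 1 + (h $ 2) *\<^sub>R axis 2 1"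
    by (simp add: vec_eq_iff forall_2 axis_def)
  show ?thesis
    by (subst h) (simp add: linear_add[OF l] linear_cmul[OF l] partial_def)
qed

lemma has_derivative_partial:
  assumes "f differentiable (at x)"
  shows "(f has_derivative (\<lambda>h. (h $ 1) *\<^sub>R partial 1 f x + (h $ 2) *\<^sub>R partial 2 f x)) (at x)"
proof -
  have "frechet_derivative f (at x) = (\<lambda>h. (h $ 1) *\<^sub>R partial 1 f x + (h $ 2) *\<^sub>R partial 2 f x)"
    by (rule ext) (rule frechet_derivative_partial[OF assms])
  then show ?thesis using assms[unfolded frechet_derivative_works] by simp
qed

lemma partial_eqI:
  assumes "(f has_derivative f') (at x)"
  shows "partial i f x = f' (axis i 1)"
  using frechet_derivative_at[OF assms] by (simp add: partial_def)

lemma partial_inner: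
  fixes F G :: "real^2 \<Rightarrow> 'b::real_inner"
  assumes "F differentiable (at x)" "G differentiable (at x)"
  shows "partial i (\<lambda>y. F y \<bullet> G y) x = partial i F x \<bullet> G x + F x \<bullet> partial i G x"
  using partial_eqI[OF has_derivative_inner[OF assms[unfolded frechet_derivative_works]], of i]
  by (simp add: partial_def)

lemma partial_cong_open:
  assumes "open S" "x \<in> S" "\<phi> differentiable (at x)" "\<And>y. y \<in> S \<Longrightarrow> \<phi> y = \<psi> y"
  shows "partial i \<phi> x = partial i \<psi> x"
proof -
  have "(\<psi> has_derivative frechet_derivative \<phi> (at x)) (at x)"
    using has_derivative_transform_within_open[OF assms(3)[unfolded frechet_derivative_works] assms(1,2,4)] .
  then show ?thesis using partial_eqI[of \<psi> _ x i] by (simp add: partial_def)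
qed

lemma partial_const: "partial i (\<lambda>_. c) x = 0"
  by (rule partial_eqI[where f' = "\<lambda>_. 0"]) simp

lemma partial_component:
  fixes F :: "real^2 \<Rightarrow> real^'n"
  assumes "F differentiable (at x)"
  shows "(\<lambda>y. c * F y $ j) differentiable (at x)" "partial i (\<lambda>y. c * F y $ j) x = c * partial i F x $ j"
proof -
  have "((\<lambda>y. c * F y $ j) has_derivative (\<lambda>h. c * frechet_derivative F (at x) h $ j)) (at x)"
    using assms[unfolded frechet_derivative_works]
    by (intro has_derivative_mult_right bounded_linear.has_derivative[OF bounded_linear_vec_nth])
  then show "(\<lambda>y. c * F y $ j) differentiable (at x)" "partial i (\<lambda>y. c * F y $ j) x = c * partial i F x $ j"
    using partial_eqI by (auto simp: differentiable_def partial_def)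
qed

lemma partial_commute:
  fixes f :: "real^2 \<Rightarrow> real^'n"
  assumes S: "open S" "x \<in> S" and f: "C_k_on 2 f S"
  shows "partial 2 (partial 1 f) x = partial 1 (partial 2 f) x"
proof -
  have f2: "C_k_on (Suc (Suc 0)) f S" using f by (simp add: numeral_2_eq_2)
  note f1 = C_k_on_partial(1)[OF f2] and fd = C_k_on_partial(2)[OF f2]
  have comp: "\<exists>g'. ((\<lambda>x. g x $ i) has_derivative g') (at y) \<and> g' (axis 1 1) = partial 1 g y $ i \<and> g' (axis 2 1) = partial 2 g y $ i"
    if "g differentiable (at y)" for g :: "real^2 \<Rightarrow> real^'n" and y i
  proof -
    have "((\<lambda>x. g x $ i) has_derivative (\<lambda>h. frechet_derivative g (at y) h $ i)) (at y)"
      using that[unfolded frechet_derivative_works] by (rule bounded_linear.has_derivative[OF bounded_linear_vec_nth])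
    then show ?thesis by (auto simp: partial_def)
  qed
  have "partial 2 (partial 1 f) x $ i = partial 1 (partial 2 f) x $ i" for i
  proof (rule mixed_derivatives_commute[OF S, of "\<lambda>x. f x $ i" "axis 1 1" "\<lambda>x. partial 1 f x $ i" "axis 2 1"
        "\<lambda>x. partial 2 f x $ i" "\<lambda>x. partial 2 (partial 1 f) x $ i" "\<lambda>x. partial 1 (partial 2 f) x $ i"])
    show "\<exists>g'. ((\<lambda>x. f x $ i) has_derivative g') (at y) \<and> g' (axis 1 1) = partial 1 f y $ i \<and> g' (axis 2 1) = partial 2 f y $ i"
      if "y \<in> S" for y using comp[OF fd[OF that]] .
    show "\<exists>g'. ((\<lambda>x. partial 1 f x $ i) has_derivative g') (at y) \<and> g' (axis 2 1) = partial 2 (partial 1 f) y $ i"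
      if "y \<in> S" for y using comp[OF C_k_on_partial(2)[OF f1 that]] by blast
    show "\<exists>g'. ((\<lambda>x. partial 2 f x $ i) has_derivative g') (at y) \<and> g' (axis 1 1) = partial 1 (partial 2 f) y $ i"
      if "y \<in> S" for y using comp[OF C_k_on_partial(2)[OF f1 that]] by blast
    show "continuous_on S (\<lambda>x. partial 2 (partial 1 f) x $ i)" "continuous_on S (\<lambda>x. partial 1 (partial 2 f) x $ i)"
      using C_k_on_partial(1)[OF f1] by (auto intro!: bounded_linear.continuous_on[OF bounded_linear_vec_nth])
  qed
  then show ?thesis by (simp add: vec_eq_iff)
qed

lemma C_k_on_3_imp_2:
  assumes f: "C_k_on 3 f S"
  shows "C_k_on 2 f S"
  unfolding numeral_2_eq_2 C_k_on.simps(2)[of "Suc 0"] C_k_on.simps(2)[of 0] C_k_on.simps(1)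
proof (intro conjI ballI allI)
  have f3: "C_k_on (Suc (Suc (Suc 0))) f S" using f by (simp add: numeral_3_eq_3)
  show "f differentiable (at y)" "(\<lambda>x. frechet_derivative f (at x) h) differentiable (at y)" if "y \<in> S" for h y
    using f3 that by simp_all
  have "\<And>y h k. y \<in> S \<Longrightarrow> (\<lambda>x. frechet_derivative (\<lambda>x. frechet_derivative f (at x) h) (at x) k) differentiable (at y)"
    using f3 by simp
  then show "continuous_on S (\<lambda>x. frechet_derivative (\<lambda>x. frechet_derivative f (at x) h) (at x) k)" for h k
    by (meson continuous_at_imp_continuous_on differentiable_imp_continuous_within)
qed


section \<open>Minimal surfaces in conformal coordinates\<close>

text \<open>Conformality gives the cross product of the two tangent vectors the norm \<open>r\<close>, so near \<open>x\<close> the normal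
  is a quotient of differentiable expressions in the first derivatives, and the norm function, which is
  not smooth at the origin, disappears.\<close>

lemma unit_normal_properties:
  fixes f :: "real^2 \<Rightarrow> real^3"
  assumes S: "open S" "x \<in> S" and f: "C_k_on 2 f S"
    and c: "\<And>y. y \<in> S \<Longrightarrow> partial 1 f y \<bullet> partial 1 f y = r y"
      "\<And>y. y \<in> S \<Longrightarrow> partial 2 f y \<bullet> partial 2 f y = r y"
      "\<And>y. y \<in> S \<Longrightarrow> partial 1 f y \<bullet> partial 2 f y = 0"
      "\<And>y. y \<in> S \<Longrightarrow> r y > 0"
  shows "unit_normal f x \<bullet> unit_normal f x = 1" "unit_normal f x \<bullet> partial 1 f x = 0"
    "unit_normal f x \<bullet> partial 2 f x = 0" "unit_normal f differentiable (at x)"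
proof -
  have N: "unit_normal f y = cross3 (partial 1 f y) (partial 2 f y) /\<^sub>R (partial 1 f y \<bullet> partial 1 f y)"
    and nz: "partial 1 f y \<bullet> partial 1 f y \<noteq> 0"
    and nc: "norm (cross3 (partial 1 f y) (partial 2 f y)) = r y" if "y \<in> S" for y
  proof -
    have "norm (cross3 (partial 1 f y) (partial 2 f y)) ^ 2 = (norm (partial 1 f y))\<^sup>2 * (norm (partial 2 f y))\<^sup>2"
      using norm_cross_dot[of "partial 1 f y" "partial 2 f y"] c(3)[OF that] by (simp add: power_mult_distrib)
    also have "\<dots> = (r y)\<^sup>2" unfolding power2_norm_eq_inner c(1,2)[OF that] by (simp add: power2_eq_square)
    finally show n: "norm (cross3 (partial 1 f y) (partial 2 f y)) = r y"
      using c(4)[OF that] by (simp add: power2_eq_iff_nonneg)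
    show "unit_normal f y = cross3 (partial 1 f y) (partial 2 f y) /\<^sub>R (partial 1 f y \<bullet> partial 1 f y)"
      using n c(1)[OF that] by (simp add: unit_normal_def Let_def partial_def)
    show "partial 1 f y \<bullet> partial 1 f y \<noteq> 0" using c[OF that] by simp
  qed
  have "cross3 (partial 1 f x) (partial 2 f x) \<bullet> cross3 (partial 1 f x) (partial 2 f x) = (r x)\<^sup>2"
    using nc[OF S(2)] by (metis power2_norm_eq_inner)
  then show "unit_normal f x \<bullet> unit_normal f x = 1"
    unfolding N[OF S(2)] using c[OF S(2)] by (simp add: power2_eq_square field_simps)
  show "unit_normal f x \<bullet> partial 1 f x = 0" "unit_normal f x \<bullet> partial 2 f x = 0"
    unfolding N[OF S(2)] by (simp_all add: dot_cross_self)
  have f2: "C_k_on (Suc (Suc 0)) f S" using f by (simp add: numeral_2_eq_2)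
  note d = C_k_on_partial(2)[OF C_k_on_partial(1)[OF f2] S(2), unfolded frechet_derivative_works]
  have bb: "bounded_bilinear cross3" using bilinear_cross bilinear_conv_bounded_bilinear by blast
  have "\<exists>D. ((\<lambda>y. cross3 (partial 1 f y) (partial 2 f y) /\<^sub>R (partial 1 f y \<bullet> partial 1 f y)) has_derivative D) (at x)"
    by (rule exI) (rule has_derivative_scaleR Deriv.has_derivative_inverse has_derivative_inner
        bounded_bilinear.FDERIV[OF bb] d nz[OF S(2)])+
  then obtain D where "((\<lambda>y. cross3 (partial 1 f y) (partial 2 f y) /\<^sub>R (partial 1 f y \<bullet> partial 1 f y)) has_derivative D) (at x)" ..
  then have "(unit_normal f has_derivative D) (at x)"
    by (rule has_derivative_transform_within_open[OF _ S]) (simp add: N)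
  then show "unit_normal f differentiable (at x)" by (auto simp: differentiable_def)
qed

text \<open>The description of the shape operator as the solution of an equation is well posed: differentiating
  \<open>N \<bullet> N = 1\<close> makes the derivative of the normal tangential, and in the conformal frame a tangential
  vector has unique coordinates.\<close>

lemma weingarten:
  fixes f :: "real^2 \<Rightarrow> real^3"
  assumes S: "open S" "x \<in> S" and f: "C_k_on 2 f S"
    and c: "\<And>y. y \<in> S \<Longrightarrow> partial 1 f y \<bullet> partial 1 f y = r y"
      "\<And>y. y \<in> S \<Longrightarrow> partial 2 f y \<bullet> partial 2 f y = r y"
      "\<And>y. y \<in> S \<Longrightarrow> partial 1 f y \<bullet> partial 2 f y = 0"
      "\<And>y. y \<in> S \<Longrightarrow> r y > 0"
  shows "partial j (unit_normal f) x =
    - (matrix (shape_operator f x) $ 1 $ j *\<^sub>R partial 1 f x + matrix (shape_operator f x) $ 2 $ j *\<^sub>R partial 2 f x)"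
proof -
  define a b where "a = partial 1 f x" and "b = partial 2 f x"
  define n where "n = unit_normal f x"
  define w where "w = partial j (unit_normal f) x"
  note u = unit_normal_properties[OF S(1) _ f c]
  have fr: "a \<bullet> a = r x" "b \<bullet> b = r x" "a \<bullet> b = 0" "r x > 0" "n \<bullet> n = 1" "n \<bullet> a = 0" "n \<bullet> b = 0"
    using c[OF S(2)] u[OF S(2)] by (auto simp: a_def b_def n_def)
  have nd: "unit_normal f differentiable (at x)" using u(4)[OF S(2)] by blast
  have "partial j (\<lambda>y. unit_normal f y \<bullet> unit_normal f y) x = partial j (\<lambda>_. 1) x"
    by (rule partial_cong_open[OF S]) (use nd u(1) in auto)
  then have wn: "w \<bullet> n = 0"
    using partial_inner[OF nd nd, of j] by (simp add: partial_const w_def n_def inner_commute)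
  have "C_k_on (Suc 1) f S" using f by (simp add: numeral_2_eq_2)
  from C_k_on_partial(2)[OF this S(2)] have fd: "f differentiable (at x)" .
  note D = frechet_derivative_partial[OF fd, folded a_def b_def]
  have ex: "w = (w \<bullet> a / r x) *\<^sub>R a + (w \<bullet> b / r x) *\<^sub>R b"
    using conformal_frame_expansion[OF fr, of w] wn by simp
  define Y where "Y = shape_operator f x (axis j 1)"
  have "\<exists>!Y. frechet_derivative f (at x) Y = - w"
  proof (rule ex1I)
    show "frechet_derivative f (at x) (vector [- (w \<bullet> a / r x), - (w \<bullet> b / r x)]) = - w"
      unfolding D vector_2 by (subst (3) ex) simp
  next
    fix Y assume "frechet_derivative f (at x) Y = - w"
    then have e: "(Y $ 1) *\<^sub>R a + (Y $ 2) *\<^sub>R b = - w" unfolding D .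
    have "(Y $ 1) * r x = - (w \<bullet> a)" "(Y $ 2) * r x = - (w \<bullet> b)"
      using arg_cong[OF e, of "\<lambda>t. t \<bullet> a"] arg_cong[OF e, of "\<lambda>t. t \<bullet> b"] fr
      by (simp_all add: inner_add_left inner_commute[of b a])
    then show "Y = vector [- (w \<bullet> a / r x), - (w \<bullet> b / r x)]"
      using fr(4) by (simp add: vec_eq_iff forall_2 vector_2 field_simps)
  qed
  from theI'[OF this] have "frechet_derivative f (at x) Y = - w"
    unfolding Y_def shape_operator_def w_def partial_def .
  then have "w = - ((Y $ 1) *\<^sub>R a + (Y $ 2) *\<^sub>R b)" unfolding D by simp
  then show ?thesis by (simp add: Y_def matrix_def a_def b_def w_def)
qed

text \<open>A vanishing shape operator makes the normal \<open>n\<close> constant, hence also \<open>f \<bullet> n\<close>.\<close>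

lemma zero_shape_operator_imp_coplanar:
  fixes f :: "real^2 \<Rightarrow> real^3"
  assumes S: "open S" "convex S" "S \<noteq> {}" and f: "C_k_on 3 f S"
    and c: "\<And>y. y \<in> S \<Longrightarrow> partial 1 f y \<bullet> partial 1 f y = r y"
      "\<And>y. y \<in> S \<Longrightarrow> partial 2 f y \<bullet> partial 2 f y = r y"
      "\<And>y. y \<in> S \<Longrightarrow> partial 1 f y \<bullet> partial 2 f y = 0"
      "\<And>y. y \<in> S \<Longrightarrow> r y > 0"
    and flat: "\<And>y. y \<in> S \<Longrightarrow> matrix (shape_operator f y) = 0"
  shows "coplanar (f ` S)"
proof -
  note C2 = C_k_on_3_imp_2[OF f]
  have fd: "f differentiable (at y)" if "y \<in> S" for y
    using f that by (simp add: numeral_3_eq_3)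
  note u = unit_normal_properties[OF S(1) _ C2 c]
  have const: "\<exists>d. \<forall>y\<in>S. g y = d"
    if "\<And>y. y \<in> S \<Longrightarrow> g differentiable (at y) \<and> partial 1 g y = 0 \<and> partial 2 g y = 0"
    for g :: "real^2 \<Rightarrow> 'b::real_normed_vector"
  proof (rule has_derivative_zero_constant[OF S(2)])
    fix y assume "y \<in> S"
    then show "(g has_derivative (\<lambda>h. 0)) (at y within S)"
      using has_derivative_partial[of g y] that[of y] by (simp add: has_derivative_at_withinI)
  qed
  have nd: "unit_normal f differentiable (at y)" if "y \<in> S" for y
    using u(4)[OF that] by blast
  have w: "partial j (unit_normal f) y = 0" if "y \<in> S" for j y
    using weingarten[OF S(1) that C2 c] by (simp add: flat[OF that])
  have "\<exists>n. \<forall>y\<in>S. unit_normal f y = n"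
    by (rule const) (use nd w in auto)
  then obtain n where n: "\<And>y. y \<in> S \<Longrightarrow> unit_normal f y = n" by blast
  have "\<exists>d. \<forall>y\<in>S. f y \<bullet> n = d"
  proof (rule const)
    fix y assume y: "y \<in> S"
    have p: "partial j f y \<bullet> n = 0" if "j = 1 \<or> j = 2" for j
      using u(2,3)[OF y] n[OF y] that by (auto simp: inner_commute)
    show "(\<lambda>y. f y \<bullet> n) differentiable (at y) \<and> partial 1 (\<lambda>y. f y \<bullet> n) y = 0 \<and> partial 2 (\<lambda>y. f y \<bullet> n) y = 0"
      using partial_inner[OF fd[OF y], of "\<lambda>_. n"] fd[OF y] p by (simp add: partial_const)
  qed
  then obtain d where d: "\<And>y. y \<in> S \<Longrightarrow> f y \<bullet> n = d" by blast
  obtain x where x: "x \<in> S" using S(3) by blast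
  have "unit_normal f x \<bullet> unit_normal f x = 1" "unit_normal f x \<bullet> partial 1 f x = 0"
    "unit_normal f x \<bullet> partial 2 f x = 0" using u(1-3)[OF x] by blast+
  then have nn: "n \<bullet> n = 1" "n \<bullet> partial 1 f x = 0" "n \<bullet> partial 2 f x = 0" using n[OF x] by simp_all
  show ?thesis
    by (rule coplanar_in_plane[OF c(1-4)[OF x] nn, of _ "f x"]) (use d x in auto)
qed

lemma strip_open_convex:
  shows "open (strip u1 u2)" "convex (strip u1 u2)"
proof -
  have "open {t. u1 < ereal t \<and> ereal t < u2}"
    by (intro open_Collect_conj open_Collect_less continuous_intros)
  then have "open ((\<lambda>x::real^2. x $ 1) -` {t. u1 < ereal t \<and> ereal t < u2})"
    by (intro open_vimage continuous_intros)
  moreover have e: "(\<lambda>x::real^2. x $ 1) -` {t. u1 < ereal t \<and> ereal t < u2} = strip u1 u2"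
    by (auto simp: strip_def)
  ultimately show "open (strip u1 u2)" by simp
  have "convex {t. u1 < ereal t \<and> ereal t < u2}"
    unfolding is_interval_convex_1[symmetric] is_interval_1
  proof (intro ballI allI impI)
    fix p q t :: real
    assume p: "p \<in> {t. u1 < ereal t \<and> ereal t < u2}" and q: "q \<in> {t. u1 < ereal t \<and> ereal t < u2}"
      and t: "p \<le> t \<and> t \<le> q"
    have "u1 < ereal p" "ereal p \<le> ereal t" "ereal t \<le> ereal q" "ereal q < u2" using p q t by simp_all
    then show "t \<in> {t. u1 < ereal t \<and> ereal t < u2}"
      by (metis (mono_tags, lifting) mem_Collect_eq less_le_trans le_less_trans)
  qed
  then have "convex ((\<lambda>x::real^2. x $ 1) -` {t. u1 < ereal t \<and> ereal t < u2})"
    by (intro convex_linear_vimage) (auto intro: bounded_linear.linear bounded_linear_vec_nth)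
  then show "convex (strip u1 u2)" unfolding e .
qed

lemma twist_matrix:
  "(rot2 (- \<theta>) ** diag2 l (- l) ** rot2 \<theta>) $ 1 $ 1 = l * cos (2 * \<theta>)"
  "(rot2 (- \<theta>) ** diag2 l (- l) ** rot2 \<theta>) $ 2 $ 1 = - l * sin (2 * \<theta>)"
  "(rot2 (- \<theta>) ** diag2 l (- l) ** rot2 \<theta>) $ 1 $ 2 = - l * sin (2 * \<theta>)"
  "(rot2 (- \<theta>) ** diag2 l (- l) ** rot2 \<theta>) $ 2 $ 2 = - l * cos (2 * \<theta>)"
  unfolding cos_double sin_double
  by (simp_all add: rot2_def diag2_def matrix_matrix_mult_def sum_2 vector_2 power2_eq_square algebra_simps)

text \<open>Everything that the later argument uses about the surface. The conformality relations are
  differentiated once; the normal components of the second derivatives are read off from the Weingarten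
  equations and the matrix of the twisted shape operator, whose angle \<open>a v\<close> is doubled there and doubled
  again by squaring, whence \<open>4 a v\<close>. In terms of \<open>\<Phi> = f\<^sub>u - \<i> f\<^sub>v\<close> the conclusions say that \<open>\<Phi>\<close>
  satisfies the Cauchy-Riemann equations, that \<open>\<Phi> \<cdot> \<Phi> = \<Phi> \<cdot> \<Phi>' = 0\<close>, and that \<open>\<Phi>' \<cdot> \<Phi>'\<close> is the
  nonnegative number \<open>(\<rho>\<^sup>2 \<lambda>\<^sub>1)\<^sup>2\<close> times \<open>exp (4 a v \<i>)\<close>.\<close>

lemma twisted_minimal_surface_derivatives:
  fixes f :: "real^2 \<Rightarrow> real^3" and x :: "real^2"
  assumes f: "C_k_on 3 f (strip u1 u2)"
    and metric: "\<forall>x\<in>strip u1 u2. \<forall>X Y. first_fundamental_form f x X Y = (\<rho> (x $ 1))\<^sup>2 * (X \<bullet> Y)"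
    and conformal_factor: "\<forall>u. u1 < ereal u \<and> ereal u < u2 \<longrightarrow> \<rho> u > 0"
    and tw: "has_twist u1 u2 f (\<lambda>v. a * v) l1 l2"
    and minimal: "\<forall>u. u1 < ereal u \<and> ereal u < u2 \<longrightarrow> l1 u + l2 u = 0"
    and x: "x \<in> strip u1 u2"
  defines "fu \<equiv> partial 1 f" and "fv \<equiv> partial 2 f"
    and "fuu \<equiv> partial 1 (partial 1 f)" and "fuv \<equiv> partial 2 (partial 1 f)"
  shows "fu x \<bullet> fu x = (\<rho> (x $ 1))\<^sup>2" "fv x \<bullet> fv x = (\<rho> (x $ 1))\<^sup>2" "fu x \<bullet> fv x = 0"
    "fu x \<bullet> fuu x = fv x \<bullet> fuv x" "fu x \<bullet> fuv x + fv x \<bullet> fuu x = 0"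
    "partial 1 (partial 2 f) x = fuv x" "partial 2 (partial 2 f) x = - fuu x"
    "fuu x \<bullet> fuu x - fuv x \<bullet> fuv x = ((\<rho> (x $ 1))\<^sup>2 * l1 (x $ 1))\<^sup>2 * cos (4 * a * x $ 2)"
    "-2 * (fuu x \<bullet> fuv x) = ((\<rho> (x $ 1))\<^sup>2 * l1 (x $ 1))\<^sup>2 * sin (4 * a * x $ 2)"
    "f differentiable (at x)" "fu differentiable (at x)" "fv differentiable (at x)"
proof -
  let ?S = "strip u1 u2"
  note S = strip_open_convex(1)[of u1 u2]
  have f3: "C_k_on (Suc (Suc (Suc 0))) f ?S" using f by (simp add: numeral_3_eq_3)
  note f2 = C_k_on_partial(1)[OF f3]
  have fd: "f differentiable (at y)" "partial i f differentiable (at y)" if "y \<in> ?S" for y i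
    using C_k_on_partial(2)[OF f3 that] C_k_on_partial(2)[OF f2 that] by auto
  show "f differentiable (at x)" "fu differentiable (at x)" "fv differentiable (at x)"
    using fd[OF x] by (simp_all add: fu_def fv_def)
  have C2: "C_k_on 2 f ?S" using f by (rule C_k_on_3_imp_2)
  define r where "r y = (\<rho> (y $ 1))\<^sup>2" for y :: "real^2"
  have c: "partial 1 f y \<bullet> partial 1 f y = r y" "partial 2 f y \<bullet> partial 2 f y = r y"
      "partial 1 f y \<bullet> partial 2 f y = 0" "r y > 0" if "y \<in> ?S" for y
    using metric[rule_format, OF that, of "axis 1 1" "axis 1 1"]
      metric[rule_format, OF that, of "axis 2 1" "axis 2 1"]
      metric[rule_format, OF that, of "axis 1 1" "axis 2 1"] conformal_factor that
    by (auto simp: first_fundamental_form_def partial_def r_def inner_axis_axis strip_def)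
  note c1 = c(1) and c2 = c(2) and c3 = c(3) and c4 = c(4)
  note u = unit_normal_properties[OF S _ C2 c1 c2 c3 c4]
  have w: "partial j (unit_normal f) x =
    - (matrix (shape_operator f x) $ 1 $ j *\<^sub>R partial 1 f x + matrix (shape_operator f x) $ 2 $ j *\<^sub>R partial 2 f x)" for j
    using weingarten[OF S x C2 c1 c2 c3 c4] .
  show c': "fu x \<bullet> fu x = (\<rho> (x $ 1))\<^sup>2" "fv x \<bullet> fv x = (\<rho> (x $ 1))\<^sup>2" "fu x \<bullet> fv x = 0"
    using c[OF x] by (simp_all add: fu_def fv_def r_def)
  show comm: "partial 1 (partial 2 f) x = fuv x"
    unfolding fuv_def by (rule partial_commute[OF S x C2, symmetric])
  define fvv where "fvv = partial 2 (partial 2 f)"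
  define n where "n = unit_normal f x"
  have nd: "unit_normal f differentiable (at x)" using u(4)[OF x] by blast
  have e: "2 * (fu x \<bullet> partial i (partial 1 f) x) = 2 * (fv x \<bullet> partial i (partial 2 f) x)" for i
  proof -
    have "partial i (\<lambda>y. partial 1 f y \<bullet> partial 1 f y) x = partial i (\<lambda>y. partial 2 f y \<bullet> partial 2 f y) x"
      by (rule partial_cong_open[OF S x]) (use fd[OF x] c in auto)
    then show ?thesis
      using partial_inner[OF fd(2)[OF x] fd(2)[OF x], of i]
      by (simp add: fu_def fv_def inner_commute)
  qed
  have e': "partial i (partial 1 f) x \<bullet> fv x + fu x \<bullet> partial i (partial 2 f) x = 0" for i
  proof -
    have "partial i (\<lambda>y. partial 1 f y \<bullet> partial 2 f y) x = partial i (\<lambda>y. 0) x"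
      by (rule partial_cong_open[OF S x]) (use fd[OF x] c in auto)
    then show ?thesis
      using partial_inner[OF fd(2)[OF x] fd(2)[OF x], of i] by (simp add: fu_def fv_def partial_const)
  qed
  have e'': "n \<bullet> partial i (partial j f) x = - (partial i (unit_normal f) x \<bullet> partial j f x)" if "j = 1 \<or> j = 2" for i j
  proof -
    have "partial i (\<lambda>y. unit_normal f y \<bullet> partial j f y) x = partial i (\<lambda>y. 0) x"
      by (rule partial_cong_open[OF S x]) (use fd[OF x] nd u(2,3) that in auto)
    then show ?thesis
      using partial_inner[OF nd fd(2)[OF x], of i] by (simp add: n_def partial_const eq_neg_iff_add_eq_0 add.commute)
  qed
  have t: "fuu x \<bullet> fu x = fuv x \<bullet> fv x" "fuv x \<bullet> fu x = fvv x \<bullet> fv x"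
    "fuu x \<bullet> fv x + fuv x \<bullet> fu x = 0" "fuv x \<bullet> fv x + fvv x \<bullet> fu x = 0"
    using e[of 1] e[of 2] e'[of 1] e'[of 2] comm by (simp_all add: fuu_def fuv_def fvv_def inner_commute)
  show "fu x \<bullet> fuu x = fv x \<bullet> fuv x" "fu x \<bullet> fuv x + fv x \<bullet> fuu x = 0"
    using t(1,3) by (simp_all add: inner_commute add.commute)
  define l where "l = l1 (x $ 1)"
  have "l2 (x $ 1) = - l" using minimal x by (auto simp: strip_def l_def)
  then have M: "matrix (shape_operator f x) = rot2 (- (a * x $ 2)) ** diag2 l (- l) ** rot2 (a * x $ 2)"
    using tw x by (simp add: has_twist_def l_def)
  \<comment> \<open>Coefficients of the second fundamental form.\<close>
  define L M where "L = r x * l * cos (2 * (a * x $ 2))" and "M = - (r x * l * sin (2 * (a * x $ 2)))"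
  have cx: "fu x \<bullet> fu x = r x" "fv x \<bullet> fv x = r x" "fu x \<bullet> fv x = 0" "fv x \<bullet> fu x = 0"
    using c[OF x] by (simp_all add: fu_def fv_def inner_commute)
  have wu: "partial 1 (unit_normal f) x = (l * sin (2 * (a * x $ 2))) *\<^sub>R fv x - (l * cos (2 * (a * x $ 2))) *\<^sub>R fu x"
    and wv: "partial 2 (unit_normal f) x = (l * sin (2 * (a * x $ 2))) *\<^sub>R fu x + (l * cos (2 * (a * x $ 2))) *\<^sub>R fv x"
    unfolding w M twist_matrix by (simp_all add: fu_def fv_def)
  have nn: "fuu x \<bullet> n = L" "fuv x \<bullet> n = M" "fvv x \<bullet> n = - L"
    using e''[of 1 1] e''[of 1 2] e''[of 2 2] cx
    unfolding wu wv by (simp_all add: fuu_def fuv_def fvv_def inner_diff_left inner_add_left inner_commute[of n]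
        L_def M_def mult_ac flip: fu_def fv_def)
  have frn: "n \<bullet> n = 1" "n \<bullet> fu x = 0" "n \<bullet> fv x = 0"
    using u(1-3)[OF x] by (simp_all add: n_def fu_def fv_def)
  note md = minimal_second_derivatives[OF cx(1-3) c4[OF x] frn t nn]
  show "partial 2 (partial 2 f) x = - fuu x" using md(1) by (simp add: fvv_def)
  have ang: "4 * a * x $ 2 = 2 * (2 * (a * x $ 2))" by simp
  show "fuu x \<bullet> fuu x - fuv x \<bullet> fuv x = ((\<rho> (x $ 1))\<^sup>2 * l1 (x $ 1))\<^sup>2 * cos (4 * a * x $ 2)"
    unfolding md(2) ang cos_double[of "2 * (a * x $ 2)"]
    by (simp add: L_def M_def r_def l_def power_mult_distrib algebra_simps)
  show "-2 * (fuu x \<bullet> fuv x) = ((\<rho> (x $ 1))\<^sup>2 * l1 (x $ 1))\<^sup>2 * sin (4 * a * x $ 2)"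
    unfolding md(3) ang sin_double[of "2 * (a * x $ 2)"]
    by (simp add: L_def M_def r_def l_def power2_eq_square algebra_simps)
qed


section \<open>Bilinear and Hermitian pairings in complex three-space\<close>

text \<open>The complex bilinear (not Hermitian) extension of the dot product. Vectors of \<open>\<complex>\<^sup>3\<close> are functions on
  the index type, so that a curve is a family of three complex functions to which the theory of holomorphic functions
  applies directly.\<close>

definition bil :: "(3 \<Rightarrow> complex) \<Rightarrow> (3 \<Rightarrow> complex) \<Rightarrow> complex" where
  "bil p q = (\<Sum>j\<in>UNIV. p j * q j)"

definition herm :: "(3 \<Rightarrow> complex) \<Rightarrow> (3 \<Rightarrow> complex) \<Rightarrow> complex" where
  "herm p q = (\<Sum>j\<in>UNIV. p j * cnj (q j))"

definition det3 :: "(3 \<Rightarrow> complex) \<Rightarrow> (3 \<Rightarrow> complex) \<Rightarrow> (3 \<Rightarrow> complex) \<Rightarrow> complex" where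
  "det3 p q r = p 1 * (q 2 * r 3 - q 3 * r 2) + p 2 * (q 3 * r 1 - q 1 * r 3)
     + p 3 * (q 1 * r 2 - q 2 * r 1)"

lemma bil_commute: "bil p q = bil q p"
  by (simp add: bil_def mult.commute)

lemma bil_linear:
  "bil (\<lambda>j. p j + q j) r = bil p r + bil q r"
  "bil (\<lambda>j. p j - q j) r = bil p r - bil q r"
  "bil (\<lambda>j. c * p j) r = c * bil p r"
  "bil r (\<lambda>j. p j + q j) = bil r p + bil r q"
  "bil r (\<lambda>j. p j - q j) = bil r p - bil r q"
  "bil r (\<lambda>j. c * p j) = c * bil r p"
  by (simp_all add: bil_def sum_3 algebra_simps)

lemma herm_linear:
  "herm (\<lambda>j. p j + q j) r = herm p r + herm q r"
  "herm (\<lambda>j. p j - q j) r = herm p r - herm q r"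
  "herm (\<lambda>j. c * p j) r = c * herm p r"
  "herm r (\<lambda>j. p j + q j) = herm r p + herm r q"
  "herm r (\<lambda>j. p j - q j) = herm r p - herm r q"
  "herm r (\<lambda>j. c * p j) = cnj c * herm r p"
  by (simp_all add: herm_def sum_3 algebra_simps)

lemma herm_bil: "herm p q = bil p (\<lambda>j. cnj (q j))"
  by (simp add: bil_def herm_def)

lemma cnj_bil: "bil (\<lambda>j. cnj (p j)) (\<lambda>j. cnj (q j)) = cnj (bil p q)"
  by (simp add: bil_def)

lemma herm_commute: "herm q p = cnj (herm p q)"
  by (simp add: herm_def mult.commute)

lemma bil_Complex:
  "bil (\<lambda>j. Complex (a $ j) (b $ j)) (\<lambda>j. Complex (c $ j) (d $ j)) = Complex (a \<bullet> c - b \<bullet> d) (a \<bullet> d + b \<bullet> c)"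
  by (simp add: bil_def inner_vec_def sum_3 complex_eq_iff)

lemma herm_Complex:
  "herm (\<lambda>j. Complex (a $ j) (b $ j)) (\<lambda>j. Complex (a $ j) (b $ j)) = of_real (a \<bullet> a + b \<bullet> b)"
  by (simp add: herm_def inner_vec_def sum_3 complex_eq_iff)

text \<open>The product of two determinants is the Gram determinant of the mutual pairings; this converts
  pairings of the derivatives of a curve into statements on their components normal to the curve.\<close>

lemma gram_identity:
  "det3 p q r * det3 p' q' r' =
     bil p p' * (bil q q' * bil r r' - bil q r' * bil r q')
   - bil p q' * (bil q p' * bil r r' - bil q r' * bil r p')
   + bil p r' * (bil q p' * bil r q' - bil q q' * bil r p')"
  unfolding bil_def det3_def sum_3 by algebra

lemma orthogonal_to_basis_eq_0:
  assumes "det3 p q r \<noteq> 0" "bil e p = 0" "bil e q = 0" "bil e r = 0"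
  shows "e j = 0"
proof -
  have "det3 p q r * e 1 = bil e p * (q 2 * r 3 - q 3 * r 2) + bil e q * (r 2 * p 3 - r 3 * p 2)
      + bil e r * (p 2 * q 3 - p 3 * q 2)"
    "det3 p q r * e 2 = bil e p * (q 3 * r 1 - q 1 * r 3) + bil e q * (r 3 * p 1 - r 1 * p 3)
      + bil e r * (p 3 * q 1 - p 1 * q 3)"
    "det3 p q r * e 3 = bil e p * (q 1 * r 2 - q 2 * r 1) + bil e q * (r 1 * p 2 - r 2 * p 1)
      + bil e r * (p 1 * q 2 - p 2 * q 1)"
    by (simp_all add: bil_def det3_def sum_3 algebra_simps)
  then have "e 1 = 0" "e 2 = 0" "e 3 = 0" using assms by simp_all
  then show ?thesis using exhaust_3[of j] by auto
qed

lemma complex_orthonormal_expansion: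
  fixes e1 e2 e3 :: "real^3"
  assumes "norm e1 = 1" "norm e2 = 1" "norm e3 = 1" "e1 \<bullet> e2 = 0" "e1 \<bullet> e3 = 0" "e2 \<bullet> e3 = 0"
  shows "p j = bil (\<lambda>i. of_real (e1 $ i)) p * of_real (e1 $ j)
     + bil (\<lambda>i. of_real (e2 $ i)) p * of_real (e2 $ j) + bil (\<lambda>i. of_real (e3 $ i)) p * of_real (e3 $ j)"
proof -
  have d: "e1 $ i * e1 $ j + e2 $ i * e2 $ j + e3 $ i * e3 $ j = (if i = j then 1 else 0)" for i j
  proof -
    have "axis i 1 $ j = ((e1 \<bullet> axis i 1) *\<^sub>R e1 + (e2 \<bullet> axis i 1) *\<^sub>R e2 + (e3 \<bullet> axis i 1) *\<^sub>R e3) $ j"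
      by (rule arg_cong[OF orthonormal_expansion[OF assms]])
    then have "e1 $ i * e1 $ j + e2 $ i * e2 $ j + e3 $ i * e3 $ j = axis i 1 $ j" by (simp add: inner_axis)
    then show ?thesis by (simp add: axis_def)
  qed
  have "p j = (\<Sum>i\<in>UNIV. of_real (if i = j then 1 else 0) * p i)"
    by (simp add: if_distrib if_distribR cong: if_cong)
  also have "\<dots> = (\<Sum>i\<in>UNIV. of_real (e1 $ i * e1 $ j + e2 $ i * e2 $ j + e3 $ i * e3 $ j) * p i)"
    by (simp only: d)
  finally show ?thesis by (simp add: bil_def sum_3 algebra_simps)
qed

text \<open>Here \<open>p\<close>, \<open>p1\<close>, \<open>p2\<close> stand for the value and the first two derivatives of a null curve at one
  point. Apply the Gram identity to \<open>D a = det3 a p (cnj p)\<close>, a multiple of the component of \<open>a\<close> normal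
  to the plane of \<open>p\<close> and \<open>cnj p\<close>: the relation \<open>(D p1 * D p2)\<^sup>2 = (D p1)\<^sup>2 * (D p2)\<^sup>2\<close> determines
  \<open>bil p2 p2\<close>, and the norm of \<open>D p1\<close> determines \<open>q2\<close>. Together they show that \<open>bil p2 p2\<close> is real and
  negative, which is why the frequencies found below are real. The first identity is the Gauss
  equation in disguise.\<close>

lemma null_curve_gram:
  fixes p p1 p2 :: "3 \<Rightarrow> complex" and C q0 q1 q2 :: real
  assumes C: "C > 0" and q0: "q0 > 0"
    and b: "bil p p = 0" "bil p p1 = 0" "bil p1 p1 = of_real C" "bil p p2 = - of_real C" "bil p1 p2 = 0"
    and h: "herm p p = of_real q0" "herm p1 p = of_real q1" "herm p2 p = of_real q2"
      "herm p1 p1 = of_real q2"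
  shows "q2 * q0 = q1\<^sup>2 + C * q0"
    and "bil p2 p2 * of_real (q0\<^sup>2) = of_real (C * q1\<^sup>2 - 2 * C * q0 * q2)"
proof -
  define c where "c = (\<lambda>j. cnj (p j))"
  define c1 where "c1 = (\<lambda>j. cnj (p1 j))"
  define D where "D a = det3 a p c" for a
  have cc: "bil c c = 0" using cnj_bil[of p p] b by (simp add: c_def)
  have pc: "bil p c = of_real q0" "bil c p = of_real q0"
    using h bil_commute[of p c] by (simp_all add: c_def herm_bil)
  have p1c: "bil p1 c = of_real q1" "bil c p1 = of_real q1"
    using h bil_commute[of p1 c] by (simp_all add: c_def herm_bil)
  have p2c: "bil p2 c = of_real q2" "bil c p2 = of_real q2"
    using h bil_commute[of p2 c] by (simp_all add: c_def herm_bil)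
  have b': "bil p1 p = 0" "bil p2 p = - of_real C" "bil p2 p1 = 0"
    using b bil_commute by metis+
  have c1: "bil c c1 = 0" "bil c1 c = 0" "bil p1 c1 = of_real q2" "bil p c1 = of_real q1" "bil c1 p = of_real q1"
  proof -
    show "bil c c1 = 0" "bil c1 c = 0"
      using cnj_bil[of p p1] cnj_bil[of p1 p] b b' by (simp_all add: c_def c1_def)
    show "bil p1 c1 = of_real q2" using h by (simp add: c1_def herm_bil)
    show "bil p c1 = of_real q1" using h herm_commute[of p p1] by (simp add: c1_def herm_bil)
    then show "bil c1 p = of_real q1" using bil_commute by metis
  qed
  have D11: "D p1 * D p1 = - of_real (C * q0\<^sup>2)"
    unfolding D_def gram_identity by (simp add: b b' cc pc p1c power2_eq_square)
  have D12: "D p1 * D p2 = - of_real (q1 * C * q0)"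
    unfolding D_def gram_identity by (simp add: b b' cc pc p1c p2c power2_eq_square)
  have D22: "D p2 * D p2 = - (bil p2 p2 * of_real (q0\<^sup>2)) - of_real (2 * C * q0 * q2)"
    unfolding D_def gram_identity by (simp add: b b' cc pc p1c p2c power2_eq_square algebra_simps)
  have "(D p1 * D p2)\<^sup>2 = (D p1 * D p1) * (D p2 * D p2)"
    by (simp add: power2_eq_square)
  then have "of_real (C * q0\<^sup>2) * (bil p2 p2 * of_real (q0\<^sup>2))
      = of_real (C * q0\<^sup>2) * (of_real (C * q1\<^sup>2 - 2 * C * q0 * q2) :: complex)"
    unfolding D11 D12 D22 by (simp add: power2_eq_square algebra_simps)
  then show "bil p2 p2 * of_real (q0\<^sup>2) = of_real (C * q1\<^sup>2 - 2 * C * q0 * q2)"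
    using C q0 by (subst (asm) mult_cancel_left) auto
  have cD: "D c1 = - cnj (D p1)"
    by (simp add: D_def c1_def c_def det3_def algebra_simps)
  have D1b: "D p1 * D c1 = of_real (q1\<^sup>2 * q0 - q2 * q0\<^sup>2)"
    unfolding D_def gram_identity by (simp add: b b' cc c1 pc p1c p2c power2_eq_square algebra_simps)
  have "of_real ((norm (D p1))\<^sup>2) = (of_real (q2 * q0\<^sup>2 - q1\<^sup>2 * q0) :: complex)"
    using D1b unfolding cD complex_norm_square by (simp add: algebra_simps)
  then have n: "(norm (D p1))\<^sup>2 = q2 * q0\<^sup>2 - q1\<^sup>2 * q0" using of_real_eq_iff by blast
  have "(norm (D p1))\<^sup>2 = norm (D p1 * D p1)" by (simp add: norm_mult power2_eq_square)
  also have "\<dots> = C * q0\<^sup>2" unfolding D11 using C by (simp add: norm_mult norm_power)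
  finally have "q0 * (q2 * q0) = q0 * (q1\<^sup>2 + C * q0)" using n by (simp add: power2_eq_square algebra_simps)
  then show "q2 * q0 = q1\<^sup>2 + C * q0" using q0 by simp
qed

text \<open>The null vector \<open>V\<close> has orthogonal real and imaginary parts of equal length \<open>v\<close>, which give \<open>e1\<close> and \<open>e2\<close>.
  A vector that is orthogonal to both \<open>V\<close> and \<open>cnj V\<close> is a multiple of the remaining unit vector, and
  a null vector that is Hermitian orthogonal to \<open>V\<close> is a multiple of \<open>cnj V\<close>; the pairings fix the
  multiples. The sign of \<open>e3\<close> is free, so the frame may be left-handed.\<close>

lemma adapted_frame:
  fixes U V W :: "3 \<Rightarrow> complex" and D :: real
  assumes D: "D > 0"
    and b: "bil U U = of_real D" "bil V V = 0" "bil W W = 0" "bil U V = 0"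
      "bil W V = - of_real (D / 2)"
    and h: "herm U V = 0" "herm W V = 0"
  obtains e1 e2 e3 :: "real^3" and v :: real where
    "norm e1 = 1" "norm e2 = 1" "norm e3 = 1" "e1 \<bullet> e2 = 0" "e1 \<bullet> e3 = 0" "e2 \<bullet> e3 = 0" "v > 0"
    "\<And>j. U j = of_real (sqrt D * e3 $ j)"
    "\<And>j. V j = of_real v * (of_real (e1 $ j) - \<i> * of_real (e2 $ j))"
    "\<And>j. W j = - of_real (D / (4 * v)) * (of_real (e1 $ j) + \<i> * of_real (e2 $ j))"
proof -
  define v1 v2 :: "real^3" where "v1 = (\<chi> j. Re (V j))" and "v2 = (\<chi> j. - Im (V j))"
  have V12: "V j = of_real (v1 $ j) - \<i> * of_real (v2 $ j)" for j
    by (simp add: v1_def v2_def complex_eq_iff)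
  have "bil V V = of_real (v1 \<bullet> v1 - v2 \<bullet> v2) - 2 * \<i> * of_real (v1 \<bullet> v2)"
    by (simp add: bil_def V12 inner_vec_def sum_3 algebra_simps)
  with b(2) have vv: "v1 \<bullet> v1 = v2 \<bullet> v2" "v1 \<bullet> v2 = 0"
    by (simp_all add: complex_eq_iff)
  define v where "v = norm v1"
  have v2: "norm v2 = v" using vv(1) by (simp add: v_def norm_eq)
  have v: "v > 0"
  proof (rule ccontr)
    assume "\<not> v > 0"
    then have "v1 = 0" "v2 = 0" using v2 by (simp_all add: v_def)
    then have "bil W V = 0" by (simp add: bil_def V12)
    with b(5) D show False by simp
  qed
  define e1 e2 where "e1 = v1 /\<^sub>R v" and "e2 = v2 /\<^sub>R v"
  define n where "n = cross3 e1 e2"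
  have e: "norm e1 = 1" "norm e2 = 1" "e1 \<bullet> e2 = 0"
    using v v2 vv by (simp_all add: e1_def e2_def v_def)
  have n: "norm n = 1" "e1 \<bullet> n = 0" "e2 \<bullet> n = 0"
    using norm_cross_dot[of e1 e2] e by (simp_all add: n_def dot_cross_self power2_eq_1_iff)
      (smt (verit) norm_ge_zero)
  define E where "E x = (\<lambda>i. complex_of_real ((x::real^3) $ i))" for x
  have VE: "V = (\<lambda>j. of_real v * (E e1 j - \<i> * E e2 j))"
    using v by (intro ext) (simp add: V12 e1_def e2_def E_def field_simps)
  have VE': "(\<lambda>j. cnj (V j)) = (\<lambda>j. of_real v * (E e1 j + \<i> * E e2 j))"
    by (auto simp: VE E_def)
  have exp: "p j = bil (E e1) p * E e1 j + bil (E e2) p * E e2 j + bil (E n) p * E n j" for p j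
    using complex_orthonormal_expansion[OF e(1,2) n(1) e(3) n(2,3), of p j] by (simp add: E_def)
  have EE: "bil (E x) (E y) = of_real (x \<bullet> y)" for x y
    by (simp add: bil_def E_def inner_vec_def)
  have sq: "bil p p = (bil (E e1) p)\<^sup>2 + (bil (E e2) p)\<^sup>2 + (bil (E n) p)\<^sup>2" for p
  proof -
    have "bil p p = (\<Sum>j\<in>UNIV. p j * (bil (E e1) p * E e1 j + bil (E e2) p * E e2 j + bil (E n) p * E n j))"
      unfolding bil_def[of p p] using exp[of p] by (intro sum.cong) auto
    also have "\<dots> = (bil (E e1) p)\<^sup>2 + (bil (E e2) p)\<^sup>2 + (bil (E n) p)\<^sup>2"
      unfolding bil_def by (simp add: sum_3 power2_eq_square algebra_simps)
    finally show ?thesis .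
  qed
  have u: "bil (E e1) U = 0" "bil (E e2) U = 0"
  proof -
    have 1: "bil (E e1) U - \<i> * bil (E e2) U = 0"
      using b(4) v unfolding VE by (simp add: bil_linear bil_commute[of U])
    have 2: "bil (E e1) U + \<i> * bil (E e2) U = 0"
      using h(1) v unfolding herm_bil VE' by (simp add: bil_linear bil_commute[of U])
    show "bil (E e1) U = 0" "bil (E e2) U = 0" using 1 2 by auto
  qed
  define r where "r = bil (E n) U"
  have "r\<^sup>2 = of_real D" using sq[of U] u b(1) by (simp add: r_def)
  then have "(r - of_real (sqrt D)) * (r + of_real (sqrt D)) = 0"
    using D by (simp add: algebra_simps power2_eq_square flip: of_real_mult)
  then have r: "r = of_real (sqrt D) \<or> r = - of_real (sqrt D)"
    by (auto simp: eq_neg_iff_add_eq_0)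
  define e3 where "e3 = (if r = of_real (sqrt D) then n else - n)"
  have e3: "norm e3 = 1" "e1 \<bullet> e3 = 0" "e2 \<bullet> e3 = 0" using n by (auto simp: e3_def)
  have U: "U j = of_real (sqrt D * e3 $ j)" for j
  proof -
    have "U j = r * E n j" using exp[of U j] u by (simp add: r_def)
    then show ?thesis using r by (auto simp: e3_def E_def)
  qed
  define w1 w2 w3 where "w1 = bil (E e1) W" and "w2 = bil (E e2) W" and "w3 = bil (E n) W"
  have 1: "of_real v * (w1 - \<i> * w2) = - of_real (D / 2)"
    using b(5) unfolding VE by (simp add: bil_linear bil_commute[of W] w1_def w2_def)
  have 2: "w1 + \<i> * w2 = 0"
    using h(2) v unfolding herm_bil VE' by (simp add: bil_linear bil_commute[of W] w1_def w2_def)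
  have "w1\<^sup>2 + w2\<^sup>2 + w3\<^sup>2 = 0" using sq[of W] b(3) by (simp add: w1_def w2_def w3_def)
  moreover have "w1\<^sup>2 + w2\<^sup>2 = (w1 + \<i> * w2) * (w1 - \<i> * w2)" by (simp add: algebra_simps power2_eq_square)
  ultimately have w3: "w3 = 0" using 2 by simp
  have w2: "w2 = \<i> * w1"
  proof -
    have "\<i> * (w1 + \<i> * w2) = 0" using 2 by simp
    then show ?thesis by (simp add: algebra_simps)
  qed
  have w1: "w1 = - of_real (D / (4 * v))"
    using 1 v unfolding w2 by (simp add: field_simps)
  have W: "W j = - of_real (D / (4 * v)) * (of_real (e1 $ j) + \<i> * of_real (e2 $ j))" for j
    using exp[of W j] unfolding w1_def[symmetric] w2_def[symmetric] w3_def[symmetric] w2 w3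
    unfolding w1 by (simp add: E_def algebra_simps)
  show ?thesis
    by (rule that[of e1 e2 e3 v]) (use e e3 v U W VE in \<open>auto simp: E_def\<close>)
qed


section \<open>Holomorphic null curves of translation-invariant length\<close>

text \<open>A nonconstant holomorphic map is open, and the real line contains no open subset of the plane.\<close>

lemma real_valued_holomorphic_constant:
  assumes "f holomorphic_on S" "open S" "connected S" "\<And>z. z \<in> S \<Longrightarrow> f z \<in> \<real>"
  shows "\<exists>c. \<forall>z\<in>S. f z = c"
proof (rule ccontr)
  assume n: "\<not> ?thesis"
  then have "S \<noteq> {}" by auto
  have "\<not> f constant_on S" using n by (auto simp: constant_on_def)
  then have "open (f ` S)"
    using open_mapping_thm[OF assms(1-3) assms(2) subset_refl] by blast
  obtain z where z: "z \<in> S" using \<open>S \<noteq> {}\<close> by blast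
  obtain e where e: "e > 0" "ball (f z) e \<subseteq> f ` S"
    using \<open>open (f ` S)\<close> z openE by blast
  have "f z + of_real (e/2) * \<i> \<in> ball (f z) e" using e(1) by (simp add: dist_norm norm_mult)
  then have "f z + of_real (e/2) * \<i> \<in> f ` S" using e(2) by (rule subsetD[rotated])
  then have "f z + of_real (e/2) * \<i> \<in> \<real>" using assms(4) by auto
  with assms(4)[OF z] e(1) show False by (simp add: complex_is_Real_iff)
qed

text \<open>The first curve contributes the dependence of the Hermitian pairing on \<open>z\<close>, the second its dependence
  on \<open>cnj z\<close>. If the pairing depends on \<open>Re z\<close> alone, its derivatives in \<open>z\<close> and in \<open>cnj z\<close> coincide, and these are the pairings
  with the first, respectively the second, curve differentiated. Both are half the derivative
  along the real axis, so they again depend on \<open>Re z\<close> alone and the argument can be iterated.\<close>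

lemma herm_derivative_shift:
  fixes A B A' B' :: "3 \<Rightarrow> complex \<Rightarrow> complex"
  assumes S: "open S"
    and A: "\<And>j z. z \<in> S \<Longrightarrow> (A j has_field_derivative A' j z) (at z)"
    and B: "\<And>j z. z \<in> S \<Longrightarrow> (B j has_field_derivative B' j z) (at z)"
    and inv: "\<And>z w. z \<in> S \<Longrightarrow> w \<in> S \<Longrightarrow> Re z = Re w \<Longrightarrow>
      herm (\<lambda>j. A j z) (\<lambda>j. B j z) = herm (\<lambda>j. A j w) (\<lambda>j. B j w)"
  shows "z \<in> S \<Longrightarrow> herm (\<lambda>j. A' j z) (\<lambda>j. B j z) = herm (\<lambda>j. A j z) (\<lambda>j. B' j z)"
    and "z \<in> S \<Longrightarrow> w \<in> S \<Longrightarrow> Re z = Re w \<Longrightarrow>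
      herm (\<lambda>j. A' j z) (\<lambda>j. B j z) = herm (\<lambda>j. A' j w) (\<lambda>j. B j w)"
proof -
  define F where "F z = herm (\<lambda>j. A j z) (\<lambda>j. B j z)" for z
  have der: "((\<lambda>s. F (z + of_real s * d)) has_vector_derivative
       (d * herm (\<lambda>j. A' j z) (\<lambda>j. B j z) + cnj d * herm (\<lambda>j. A j z) (\<lambda>j. B' j z))) (at 0)"
    if "z \<in> S" for z d
  proof -
    have l: "((\<lambda>s. z + of_real s * d) has_vector_derivative d) (at 0)"
      by (auto intro!: derivative_eq_intros simp: has_vector_derivative_def scaleR_conv_of_real)
    have a: "((\<lambda>s. A j (z + of_real s * d)) has_vector_derivative (d * A' j z)) (at 0)" for j
      using field_vector_diff_chain_at[OF l, of "A j" "A' j z"] A[OF that] by (simp add: o_def)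
    have b: "((\<lambda>s. B j (z + of_real s * d)) has_vector_derivative (d * B' j z)) (at 0)" for j
      using field_vector_diff_chain_at[OF l, of "B j" "B' j z"] B[OF that] by (simp add: o_def)
    have b': "((\<lambda>s. cnj (B j (z + of_real s * d))) has_vector_derivative (cnj (d * B' j z))) (at 0)" for j
      by (rule has_vector_derivative_cnj[OF b])
    have "((\<lambda>s. \<Sum>j\<in>UNIV. A j (z + of_real s * d) * cnj (B j (z + of_real s * d)))
        has_vector_derivative
        (\<Sum>j\<in>UNIV. A j (z + of_real 0 * d) * cnj (d * B' j z) + (d * A' j z) * cnj (B j (z + of_real 0 * d)))) (at 0)"
      by (intro has_vector_derivative_sum has_vector_derivative_mult a b')
    then show ?thesis
      by (simp add: F_def[abs_def] herm_def sum.distrib sum_distrib_left mult_ac add_ac)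
  qed
  have near: "\<forall>\<^sub>F s in nhds 0. z + of_real s * d \<in> S" if "z \<in> S" for z d
  proof -
    have "filterlim (\<lambda>s::real. z + of_real s * d) (nhds z) (nhds 0)"
      by (auto intro!: tendsto_eq_intros filterlim_ident)
    then show ?thesis using S that by (rule topological_tendstoD)
  qed
  show eq: "herm (\<lambda>j. A' j z) (\<lambda>j. B j z) = herm (\<lambda>j. A j z) (\<lambda>j. B' j z)" if z: "z \<in> S" for z
  proof -
    have "\<forall>\<^sub>F s in nhds 0. F (z + of_real s * \<i>) = F z"
      using near[OF z, of \<i>] by eventually_elim (auto simp: F_def intro!: inv z)
    with eventually_nhds_x_imp_x[OF this] have "((\<lambda>s. F (z + of_real s * \<i>)) has_vector_derivative 0) (at 0)"
      by (subst has_vector_derivative_cong_ev[where g = "\<lambda>_. F z"]) auto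
    from vector_derivative_unique_at[OF this der[OF z, of \<i>]]
    show ?thesis by simp
  qed
  show "herm (\<lambda>j. A' j z) (\<lambda>j. B j z) = herm (\<lambda>j. A' j w) (\<lambda>j. B j w)"
    if z: "z \<in> S" and w: "w \<in> S" and re: "Re z = Re w" for z w
  proof -
    have "\<forall>\<^sub>F s in nhds 0. F (z + of_real s * 1) = F (w + of_real s * 1)"
      using near[OF z, of 1] near[OF w, of 1] by eventually_elim (auto simp: F_def re intro!: inv)
    with eventually_nhds_x_imp_x[OF this] have "((\<lambda>s. F (z + of_real s * 1)) has_vector_derivative
        (1 * herm (\<lambda>j. A' j w) (\<lambda>j. B j w) + cnj 1 * herm (\<lambda>j. A j w) (\<lambda>j. B' j w))) (at 0)"
      using der[OF w, of 1]
      by (subst has_vector_derivative_cong_ev[where g = "\<lambda>s. F (w + of_real s * 1)"])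
         auto
    from vector_derivative_unique_at[OF this der[OF z, of 1]]
    show ?thesis using eq[OF z] eq[OF w] by simp
  qed
qed

text \<open>The invariance of the Hermitian length makes \<open>\<beta> = P'' \<cdot> P''\<close> real, hence constant, and negative,
  say \<open>\<beta> = - C k\<^sup>2\<close>. Then \<open>P''' - k\<^sup>2 P'\<close> is orthogonal to the basis \<open>P\<close>, \<open>P'\<close>, \<open>P''\<close> and vanishes,
  so \<open>P = U + exp (k z) V + exp (- k z) W\<close>. All pairings of \<open>U\<close>, \<open>V\<close>, \<open>W\<close> can be computed at a single
  point from those of the derivatives of \<open>P\<close>, and they put the three vectors into the normal form of
  an adapted frame.\<close>

lemma null_curve_exponential_form:
  fixes P :: "3 \<Rightarrow> complex \<Rightarrow> complex" and C :: real
  assumes S: "open S" "convex S" "S \<noteq> {}" and C: "C > 0"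
    and hol: "\<And>j. P j holomorphic_on S"
    and null: "\<And>z. z \<in> S \<Longrightarrow> bil (\<lambda>j. P j z) (\<lambda>j. P j z) = 0"
    and speed: "\<And>z. z \<in> S \<Longrightarrow> bil (\<lambda>j. deriv (P j) z) (\<lambda>j. deriv (P j) z) = of_real C"
    and inv: "\<And>z w. z \<in> S \<Longrightarrow> w \<in> S \<Longrightarrow> Re z = Re w \<Longrightarrow>
      herm (\<lambda>j. P j z) (\<lambda>j. P j z) = herm (\<lambda>j. P j w) (\<lambda>j. P j w)"
  obtains e1 e2 e3 :: "real^3" and k v :: real where
    "norm e1 = 1" "norm e2 = 1" "norm e3 = 1" "e1 \<bullet> e2 = 0" "e1 \<bullet> e3 = 0" "e2 \<bullet> e3 = 0" "k > 0" "v > 0"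
    "\<And>j z. z \<in> S \<Longrightarrow> P j z = of_real (sqrt C / k * e3 $ j)
       + of_real v * exp (of_real k * z) * (of_real (e1 $ j) - \<i> * of_real (e2 $ j))
       - of_real (C / (4 * k\<^sup>2 * v)) * exp (- of_real k * z) * (of_real (e1 $ j) + \<i> * of_real (e2 $ j))"
proof -
  define Q where "Q n z = (\<lambda>j. (deriv ^^ n) (P j) z)" for n z
  have Qd: "((\<lambda>z. Q n z j) has_field_derivative Q (Suc n) z j) (at z)" if "z \<in> S" for n z j
    using holomorphic_derivI[OF holomorphic_higher_deriv[OF hol S(1)] S(1) that] by (simp add: Q_def)
  have bd: "((\<lambda>z. bil (Q m z) (Q n z)) has_field_derivative
      bil (Q (Suc m) z) (Q n z) + bil (Q m z) (Q (Suc n) z)) (at z)" if "z \<in> S" for m n z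
  proof -
    have "((\<lambda>z. \<Sum>j\<in>UNIV. Q m z j * Q n z j) has_field_derivative
      (\<Sum>j\<in>UNIV. Q (Suc m) z j * Q n z j + Q (Suc n) z j * Q m z j)) (at z)"
      by (intro DERIV_sum DERIV_mult Qd that)
    then show ?thesis by (simp add: bil_def sum.distrib mult.commute)
  qed
  have bconst: "bil (Q (Suc m) z) (Q n z) + bil (Q m z) (Q (Suc n) z) = 0"
    if "\<And>z. z \<in> S \<Longrightarrow> bil (Q m z) (Q n z) = c" "z \<in> S" for m n c z
  proof -
    have "((\<lambda>_. c) has_field_derivative
      bil (Q (Suc m) z) (Q n z) + bil (Q m z) (Q (Suc n) z)) (at z)"
      by (rule has_field_derivative_transform_within_open[OF bd[OF that(2), of m n] S(1) that(2)])
        (simp add: that(1))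
    from DERIV_unique[OF this DERIV_const] show ?thesis .
  qed
  note SS = numeral_2_eq_2 numeral_3_eq_3
  \<comment> \<open>Bilinear pairings of the derivatives, by repeated differentiation of \<open>null\<close> and \<open>speed\<close>.\<close>
  have b00: "bil (Q 0 z) (Q 0 z) = 0" if "z \<in> S" for z using null[OF that] by (simp add: Q_def)
  have b01: "bil (Q 0 z) (Q 1 z) = 0" if "z \<in> S" for z
    using bconst[OF b00 that] bil_commute[of "Q 1 z"] by simp
  have b11: "bil (Q 1 z) (Q 1 z) = of_real C" if "z \<in> S" for z using speed[OF that] by (simp add: Q_def)
  have b02: "bil (Q 0 z) (Q 2 z) = - of_real C" if "z \<in> S" for z
    using bconst[OF b01 that] b11[OF that] by (simp add: SS eq_neg_iff_add_eq_0 add.commute)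
  have b12: "bil (Q 1 z) (Q 2 z) = 0" if "z \<in> S" for z
    using bconst[OF b11 that] bil_commute[of "Q 2 z"] by (simp add: SS)
  have b03: "bil (Q 0 z) (Q 3 z) = 0" if "z \<in> S" for z
    using bconst[OF b02 that] b12[OF that] by (simp add: SS)
  have b13: "bil (Q 1 z) (Q 3 z) = - bil (Q 2 z) (Q 2 z)" if "z \<in> S" for z
    using bconst[OF b12 that] by (simp add: SS eq_neg_iff_add_eq_0 add.commute)
  \<comment> \<open>Hermitian pairings: \<open>herm (Q m z) (Q n z)\<close> depends only on \<open>m + n\<close> and on \<open>Re z\<close>.\<close>
  define rdep where "rdep m n \<longleftrightarrow> (\<forall>z\<in>S. \<forall>w\<in>S. Re z = Re w \<longrightarrow> herm (Q m z) (Q n z) = herm (Q m w) (Q n w))" for m n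
  have shift: "herm (Q (Suc m) z) (Q n z) = herm (Q m z) (Q (Suc n) z)"
    if "rdep m n" "z \<in> S" for m n z
    by (rule herm_derivative_shift(1)[OF S(1) Qd Qd _ that(2)]; (assumption | use that(1)[unfolded rdep_def] in blast))
  have rdep_Suc: "rdep (Suc m) n" if "rdep m n" for m n
    unfolding rdep_def
  proof (intro ballI impI)
    fix z w assume zw: "z \<in> S" "w \<in> S" "Re z = Re w"
    show "herm (Q (Suc m) z) (Q n z) = herm (Q (Suc m) w) (Q n w)"
      by (rule herm_derivative_shift(2)[OF S(1) Qd Qd _ zw]; (assumption | use that(1)[unfolded rdep_def] in blast))
  qed
  have r00: "rdep 0 0" using inv unfolding rdep_def Q_def funpow_0 by blast
  have r10: "rdep 1 0" using rdep_Suc[OF r00] by simp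
  have r20: "rdep 2 0" using rdep_Suc[OF r10] by (simp add: SS)
  have h01: "herm (Q 1 z) (Q 0 z) = herm (Q 0 z) (Q 1 z)" if "z \<in> S" for z
    using shift[OF r00 that] by simp
  have h11: "herm (Q 2 z) (Q 0 z) = herm (Q 1 z) (Q 1 z)" if "z \<in> S" for z
    using shift[OF r10 that] by (simp add: SS)
  have h12: "herm (Q 3 z) (Q 0 z) = herm (Q 2 z) (Q 1 z)" if "z \<in> S" for z
    using shift[OF r20 that] by (simp add: SS)
  have r21: "rdep 2 1"
    using rdep_Suc[OF r20] h12 unfolding rdep_def SS by metis
  have h22: "herm (Q 3 z) (Q 1 z) = herm (Q 2 z) (Q 2 z)" if "z \<in> S" for z
    using shift[OF r21 that] by (simp add: SS)
  define q0 q1 q2 where "q0 z = Re (herm (Q 0 z) (Q 0 z))" and "q1 z = Re (herm (Q 1 z) (Q 0 z))"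
    and "q2 z = Re (herm (Q 1 z) (Q 1 z))" for z
  have self_real: "herm p p = of_real (Re (herm p p))" for p
    using herm_commute[of p p] by (simp add: complex_eq_iff)
  have h: "herm (Q 0 z) (Q 0 z) = of_real (q0 z)" "herm (Q 1 z) (Q 0 z) = of_real (q1 z)"
    "herm (Q 2 z) (Q 0 z) = of_real (q2 z)" "herm (Q 1 z) (Q 1 z) = of_real (q2 z)" if "z \<in> S" for z
  proof -
    show "herm (Q 0 z) (Q 0 z) = of_real (q0 z)" unfolding q0_def by (rule self_real)
    show "herm (Q 1 z) (Q 1 z) = of_real (q2 z)" unfolding q2_def by (rule self_real)
    then show "herm (Q 2 z) (Q 0 z) = of_real (q2 z)" using h11[OF that] by simp
    show "herm (Q 1 z) (Q 0 z) = of_real (q1 z)"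
      using h01[OF that] herm_commute[of "Q 0 z" "Q 1 z"] by (simp add: q1_def complex_eq_iff)
  qed
  have q0: "q0 z > 0" if "z \<in> S" for z
  proof (rule ccontr)
    have e: "q0 z = (\<Sum>j\<in>UNIV. (norm (Q 0 z j))\<^sup>2)"
      by (simp add: q0_def herm_def complex_mult_cnj cmod_power2)
    assume "\<not> q0 z > 0"
    then have "(\<Sum>j\<in>UNIV. (norm (Q 0 z j))\<^sup>2) = 0" using e by (simp add: sum_nonneg order_antisym)
    then have "Q 0 z j = 0" for j by (simp add: sum_nonneg_eq_0_iff)
    then have "bil (Q 0 z) (Q 2 z) = 0" by (simp add: bil_def)
    with b02[OF that] C show False by simp
  qed
  define \<beta> where "\<beta> z = bil (Q 2 z) (Q 2 z)" for z
  have beta: "\<beta> z * of_real ((q0 z)\<^sup>2) = of_real (- C * (q1 z)\<^sup>2 - 2 * C\<^sup>2 * q0 z)" if "z \<in> S" for z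
  proof -
    note g = null_curve_gram[OF C q0[OF that] b00[OF that] b01[OF that] b11[OF that] b02[OF that] b12[OF that] h[OF that]]
    have "C * (q1 z)\<^sup>2 - 2 * C * q0 z * q2 z = C * (q1 z)\<^sup>2 - 2 * C * (q2 z * q0 z)" by simp
    also have "\<dots> = - C * (q1 z)\<^sup>2 - 2 * C\<^sup>2 * q0 z"
      unfolding g(1) by (simp add: power2_eq_square algebra_simps)
    finally show ?thesis using g(2) unfolding \<beta>_def by (simp only:)
  qed
  have beta_eq: "\<beta> z = of_real ((- C * (q1 z)\<^sup>2 - 2 * C\<^sup>2 * q0 z) / (q0 z)\<^sup>2)" if "z \<in> S" for z
    using beta[OF that] q0[OF that] by (simp add: field_simps)
  have "\<beta> holomorphic_on S"
    unfolding holomorphic_on_open[OF S(1)] \<beta>_def[abs_def] using bd by blast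
  then have "\<exists>c. \<forall>z\<in>S. \<beta> z = c"
    using S by (intro real_valued_holomorphic_constant)
      (auto simp: convex_connected beta_eq simp del: of_real_divide)
  then obtain c where c: "\<And>z. z \<in> S \<Longrightarrow> \<beta> z = c" by blast
  obtain z0 where z0: "z0 \<in> S" using S by blast
  \<comment> \<open>\<open>K\<close> is \<open>- \<beta> / C\<close>, read off at \<open>z0\<close>.\<close>
  define K where "K = (C * (q1 z0)\<^sup>2 + 2 * C\<^sup>2 * q0 z0) / (q0 z0)\<^sup>2 / C"
  have K: "K > 0" using C q0[OF z0] unfolding K_def
    by (intro divide_pos_pos add_nonneg_pos) auto
  have "(- C * (q1 z0)\<^sup>2 - 2 * C\<^sup>2 * q0 z0) / (q0 z0)\<^sup>2 = - (C * K)"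
    using C by (simp add: K_def minus_divide_left)
  then have "c = of_real (- (C * K))" using c[OF z0] beta_eq[OF z0] by metis
  then have b22: "bil (Q 2 z) (Q 2 z) = - of_real (C * K)" if "z \<in> S" for z
    using c[OF that] by (simp add: \<beta>_def)
  have b23: "bil (Q 2 z) (Q 3 z) = 0" if "z \<in> S" for z
    using bconst[OF b22 that] bil_commute[of "Q 3 z"] by (simp add: SS)
  \<comment> \<open>Keeps \<open>Q 1\<close> in the form in which the pairings are stated.\<close>
  note One_nat_def [simp del]
  have ode: "Q 3 z j = of_real K * Q 1 z j" if z: "z \<in> S" for z j
  proof -
    note bb = b00[OF z] b01[OF z] b11[OF z] b02[OF z] b12[OF z] b03[OF z] b13[OF z] b22[OF z] b23[OF z]
    note bc = bil_commute[of "Q 1 z" "Q 0 z"] bil_commute[of "Q 2 z" "Q 0 z"] bil_commute[of "Q 2 z" "Q 1 z"]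
      bil_commute[of "Q 3 z" "Q 0 z"] bil_commute[of "Q 3 z" "Q 1 z"] bil_commute[of "Q 3 z" "Q 2 z"]
    have "det3 (Q 0 z) (Q 1 z) (Q 2 z) * det3 (Q 0 z) (Q 1 z) (Q 2 z) = - of_real (C ^ 3)"
      unfolding gram_identity
      by (simp add: bb bc power3_eq_cube)
    then have d: "det3 (Q 0 z) (Q 1 z) (Q 2 z) \<noteq> 0" using C by auto
    have "Q 3 z j - of_real K * Q 1 z j = 0"
      by (rule orthogonal_to_basis_eq_0[OF d, where e = "\<lambda>j. Q 3 z j - of_real K * Q 1 z j"])
        (simp_all add: bil_linear bb bc)
    then show ?thesis by simp
  qed
  define k where "k = sqrt K"
  have k: "k > 0" "of_real K = (of_real k :: complex)\<^sup>2" "K = k\<^sup>2" using K by (simp_all add: k_def flip: of_real_power)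
  have k0: "complex_of_real k \<noteq> 0" using k by simp
  \<comment> \<open>The coefficients of the curve with respect to the solutions \<open>1\<close>, \<open>exp (k z)\<close>, \<open>exp (- k z)\<close>
    of \<open>ode\<close>.\<close>
  define c0 where "c0 = 1 / (complex_of_real k)\<^sup>2"
  have c0: "c0 = 1 / (complex_of_real k)\<^sup>2" "(of_real k)\<^sup>2 * c0 = 1"
    using k0 by (simp_all add: c0_def)
  define c1 where "c1 = 1 / (2 * (complex_of_real k)\<^sup>2)"
  define U where "U z = (\<lambda>j. Q 0 z j - c0 * Q 2 z j)" for z
  define V where "V z = (\<lambda>j. c1 * exp (- of_real k * z) * (of_real k * Q 1 z j + Q 2 z j))" for z
  define W where "W z = (\<lambda>j. c1 * exp (of_real k * z) * (Q 2 z j - of_real k * Q 1 z j))" for z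
  have Qd': "((\<lambda>z. Q 0 z j) has_field_derivative Q 1 z j) (at z)"
    "((\<lambda>z. Q 1 z j) has_field_derivative Q 2 z j) (at z)"
    "((\<lambda>z. Q 2 z j) has_field_derivative of_real k ^ 2 * Q 1 z j) (at z)" if "z \<in> S" for z j
    using Qd[OF that, of 0 j] Qd[OF that, of 1 j] Qd[OF that, of 2 j] ode[OF that, of j] k by (simp_all add: SS One_nat_def)
  have const: "F z = F z0" if "\<And>z. z \<in> S \<Longrightarrow> (F has_field_derivative 0) (at z)" "z \<in> S" for F :: "complex \<Rightarrow> complex" and z
    using has_field_derivative_zero_constant[OF S(2), of F] that z0
    by (metis has_field_derivative_at_within)
  have Uc: "U z j = U z0 j" if "z \<in> S" for z j
    using that unfolding U_def
    by (intro const[where F = "\<lambda>z. Q 0 z j - c0 * Q 2 z j"])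
      (auto intro!: derivative_eq_intros Qd' simp: c0(2))
  have Vc: "V z j = V z0 j" if "z \<in> S" for z j
    using that unfolding V_def
    by (intro const[where F = "\<lambda>z. c1 * exp (- of_real k * z) * (of_real k * Q 1 z j + Q 2 z j)"])
      (auto intro!: derivative_eq_intros Qd' simp: algebra_simps power2_eq_square)
  have Wc: "W z j = W z0 j" if "z \<in> S" for z j
    using that unfolding W_def
    by (intro const[where F = "\<lambda>z. c1 * exp (of_real k * z) * (Q 2 z j - of_real k * Q 1 z j)"])
      (auto intro!: derivative_eq_intros Qd' simp: algebra_simps power2_eq_square)
  have sol: "P j z = U z0 j + exp (of_real k * z) * V z0 j + exp (- of_real k * z) * W z0 j" if "z \<in> S" for z j
  proof -
    have "U z j + exp (of_real k * z) * V z j + exp (- of_real k * z) * W z j = Q 0 z j"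
      using k0 by (simp add: U_def V_def W_def c0(1) c1_def exp_minus field_simps)
    then show ?thesis unfolding Uc[OF that, of j] Vc[OF that, of j] Wc[OF that, of j] by (simp add: Q_def)
  qed
  note bb = b00[OF z0] b01[OF z0] b11[OF z0] b02[OF z0] b12[OF z0] b22[OF z0]
    bil_commute[of "Q 1 z0" "Q 0 z0"] bil_commute[of "Q 2 z0" "Q 0 z0"] bil_commute[of "Q 2 z0" "Q 1 z0"]
  have Q3: "Q 3 z0 = (\<lambda>j. of_real K * Q 1 z0 j)" using ode[OF z0] by auto
  have h02: "herm (Q 0 z0) (Q 2 z0) = of_real (q2 z0)" "herm (Q 0 z0) (Q 1 z0) = of_real (q1 z0)"
    using herm_commute[of "Q 0 z0" "Q 2 z0"] herm_commute[of "Q 0 z0" "Q 1 z0"] h[OF z0] by simp_all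
  have h21: "herm (Q 2 z0) (Q 1 z0) = of_real (K * q1 z0)"
    using h12[OF z0] h[OF z0] unfolding Q3 by (simp add: herm_linear)
  have h12': "herm (Q 1 z0) (Q 2 z0) = of_real (K * q1 z0)"
    using herm_commute[of "Q 1 z0" "Q 2 z0"] unfolding h21 by simp
  have h22': "herm (Q 2 z0) (Q 2 z0) = of_real (K * q2 z0)"
    using h22[OF z0] h[OF z0] unfolding Q3 by (simp add: herm_linear)
  note hh = h[OF z0] h02 h21 h12' h22'
  have E: "exp (complex_of_real k * z) \<noteq> 0" "exp (- (complex_of_real k * z)) * exp (complex_of_real k * z) = 1" for z
    by (simp_all flip: exp_add)
  have fr1: "C / K > 0" using C K by simp
  have fr2: "bil (U z0) (U z0) = of_real (C / K)"
    unfolding U_def bil_linear using k0 by (simp add: c0(1) c1_def bb k field_simps power2_eq_square)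
  have fr3: "bil (V z0) (V z0) = 0"
    unfolding V_def bil_linear using k0 by (simp add: c0(1) c1_def bb k field_simps power2_eq_square)
  have fr4: "bil (W z0) (W z0) = 0"
    unfolding W_def bil_linear using k0 by (simp add: c0(1) c1_def bb k field_simps power2_eq_square)
  have fr5: "bil (U z0) (V z0) = 0"
    unfolding U_def V_def bil_linear using k0 by (simp add: c0(1) c1_def bb k field_simps power2_eq_square)
  have fr6: "bil (W z0) (V z0) = - of_real (C / K / 2)"
    unfolding W_def V_def bil_linear using k0 E by (simp add: c0(1) c1_def bb k exp_minus field_simps power2_eq_square)
  have fr7: "herm (U z0) (V z0) = 0"
    unfolding U_def V_def herm_linear using k0 by (simp add: c0(1) c1_def hh k field_simps power2_eq_square)
  have fr8: "herm (W z0) (V z0) = 0"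
    unfolding W_def V_def herm_linear using k0 by (simp add: c0(1) c1_def hh k field_simps power2_eq_square)
  obtain e1 e2 e3 v where fr: "norm e1 = 1" "norm e2 = 1" "norm e3 = 1" "e1 \<bullet> e2 = 0" "e1 \<bullet> e3 = 0" "e2 \<bullet> e3 = 0" "v > 0"
    "\<And>j. U z0 j = of_real (sqrt (C / K) * e3 $ j)"
    "\<And>j. V z0 j = of_real v * (of_real (e1 $ j) - \<i> * of_real (e2 $ j))"
    "\<And>j. W z0 j = - of_real (C / K / (4 * v)) * (of_real (e1 $ j) + \<i> * of_real (e2 $ j))"
    by (rule adapted_frame[OF fr1 fr2 fr3 fr4 fr5 fr6 fr7 fr8]) (rule that; (assumption | blast))
  show ?thesis
    by (rule that[OF fr(1-6) k(1) fr(7)])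
      (simp add: sol fr(8-10) k(3) real_sqrt_divide k(1) order_less_imp_le mult_ac)
qed


section \<open>The coordinate strip as a complex domain\<close>

definition of_cplx :: "complex \<Rightarrow> real^2" where
  "of_cplx z = vector [Re z, Im z]"

lemma of_cplx_simps [simp]:
  "of_cplx z $ 1 = Re z" "of_cplx z $ 2 = Im z" "to_complex (of_cplx z) = z" "of_cplx (to_complex x) = x"
  by (simp_all add: of_cplx_def to_complex_def vec_eq_iff forall_2 vector_2)

lemma to_complex_strip:
  "to_complex ` strip u1 u2 = {z. u1 < ereal (Re z) \<and> ereal (Re z) < u2}"
proof -
  have "z \<in> to_complex ` strip u1 u2" if "u1 < ereal (Re z)" "ereal (Re z) < u2" for z
    by (rule image_eqI[of _ _ "of_cplx z"]) (use that in \<open>simp_all add: strip_def\<close>)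
  then show ?thesis by (auto simp: strip_def to_complex_def)
qed

lemma linear_to_complex: "linear to_complex"
  by (auto simp: linear_iff to_complex_def complex_eq_iff)

lemma linear_of_cplx: "linear of_cplx"
  by (auto simp: linear_iff vec_eq_iff forall_2)

lemma to_complex_strip_open_convex:
  "open (to_complex ` strip u1 u2)" "convex (to_complex ` strip u1 u2)"
proof -
  have "to_complex ` strip u1 u2 = of_cplx -` strip u1 u2"
    unfolding to_complex_strip by (auto simp: strip_def)
  moreover have "continuous_on UNIV of_cplx"
    by (intro linear_continuous_on linear_conv_bounded_linear[THEN iffD1] linear_of_cplx)
  ultimately show "open (to_complex ` strip u1 u2)"
    using strip_open_convex(1)[of u1 u2] open_vimage by metis
  show "convex (to_complex ` strip u1 u2)"
    by (rule convex_linear_image[OF linear_to_complex strip_open_convex(2)])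
qed

lemma cauchy_riemann_has_field_derivative:
  fixes a b :: "real^2 \<Rightarrow> real"
  assumes "a differentiable (at (of_cplx z))" "b differentiable (at (of_cplx z))"
    and cr: "partial 1 a (of_cplx z) = partial 2 b (of_cplx z)" "partial 2 a (of_cplx z) = - partial 1 b (of_cplx z)"
  shows "((\<lambda>w. Complex (a (of_cplx w)) (b (of_cplx w))) has_field_derivative
    Complex (partial 1 a (of_cplx z)) (partial 1 b (of_cplx z))) (at z)"
proof -
  have q: "(of_cplx has_derivative of_cplx) (at z)"
    by (rule linear_imp_has_derivative[OF linear_of_cplx])
  have da: "((\<lambda>w. a (of_cplx w)) has_derivative
      (\<lambda>h. Re h * partial 1 a (of_cplx z) + Im h * partial 2 a (of_cplx z))) (at z)"
    using has_derivative_compose[OF q has_derivative_partial[OF assms(1)]] by simp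
  have db: "((\<lambda>w. b (of_cplx w)) has_derivative
      (\<lambda>h. Re h * partial 1 b (of_cplx z) + Im h * partial 2 b (of_cplx z))) (at z)"
    using has_derivative_compose[OF q has_derivative_partial[OF assms(2)]] by simp
  have "((\<lambda>w. of_real (a (of_cplx w)) + \<i> * of_real (b (of_cplx w))) has_derivative
    (\<lambda>h. of_real (Re h * partial 1 a (of_cplx z) + Im h * partial 2 a (of_cplx z))
      + \<i> * of_real (Re h * partial 1 b (of_cplx z) + Im h * partial 2 b (of_cplx z)))) (at z)"
    by (intro has_derivative_add has_derivative_mult_right has_derivative_of_real da db)
  moreover have "(\<lambda>h. of_real (Re h * partial 1 a (of_cplx z) + Im h * partial 2 a (of_cplx z))
      + \<i> * of_real (Re h * partial 1 b (of_cplx z) + Im h * partial 2 b (of_cplx z)))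
    = (*) (Complex (partial 1 a (of_cplx z)) (partial 1 b (of_cplx z)))"
    by (rule ext) (simp add: complex_eq_iff cr algebra_simps)
  ultimately show ?thesis
    unfolding has_field_derivative_def Complex_eq by simp
qed

text \<open>The radii are the exponentials of the end points of the translated strip; an infinite left end
  becomes the inner radius \<open>0\<close>, an infinite right end the outer radius \<open>\<infinity>\<close>.\<close>

lemma translated_strip_annulus_cover:
  assumes "u1 < u2"
  obtains r1 :: real and r2 :: ereal where "0 \<le> r1" "ereal r1 < r2"
    "annulus_cover r1 r2 = {z. u1 < ereal (Re z - t) \<and> ereal (Re z - t) < u2}"
proof -
  define r1 where "r1 = (case u1 of ereal s \<Rightarrow> exp (s + t) | _ \<Rightarrow> 0)"
  define r2 where "r2 = (case u2 of ereal s \<Rightarrow> ereal (exp (s + t)) | _ \<Rightarrow> \<infinity>)"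
  have e1: "r1 < exp x \<longleftrightarrow> u1 < ereal (x - t)" for x
  proof (cases u1)
    case (real s)
    have "s + t < x \<longleftrightarrow> s < x - t" by linarith
    with real show ?thesis by (simp add: r1_def)
  qed (use assms in \<open>auto simp: r1_def\<close>)
  have e2: "ereal (exp x) < r2 \<longleftrightarrow> ereal (x - t) < u2" for x
  proof (cases u2)
    case (real s)
    have "x < s + t \<longleftrightarrow> x - t < s" by linarith
    with real show ?thesis by (simp add: r2_def)
  qed (use assms in \<open>auto simp: r2_def\<close>)
  have "0 \<le> r1" by (cases u1) (auto simp: r1_def)
  moreover have "ereal r1 < r2"
    using assms by (cases u1; cases u2) (auto simp: r1_def r2_def)
  moreover have "annulus_cover r1 r2 = {z. u1 < ereal (Re z - t) \<and> ereal (Re z - t) < u2}"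
    by (auto simp: annulus_cover_def annulus0_def e1 e2)
  ultimately show thesis by (rule that)
qed


section \<open>Weierstrass data\<close>

lemma weierstrass_surface_from_primitive:
  assumes z0: "z0 \<in> D"
    and F: "\<And>k z. z \<in> D \<Longrightarrow> (F k has_field_derivative weierstrass_integrand G h z $ k) (at z)"
  shows "weierstrass_surface_on D G h (\<lambda>z. \<chi> k. Re (F k z - F k z0))"
  unfolding weierstrass_surface_on_def
proof (intro bexI[OF _ z0] allI impI)
  fix \<gamma> k assume g: "valid_path \<gamma> \<and> path_image \<gamma> \<subseteq> D \<and> pathstart \<gamma> = z0"
  have "((\<lambda>z. weierstrass_integrand G h z $ k) has_contour_integral (F k (pathfinish \<gamma>) - F k (pathstart \<gamma>))) \<gamma>"
    by (rule contour_integral_primitive[of D]) (use g has_field_derivative_at_within[OF F] in auto)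
  then show "(\<lambda>z. weierstrass_integrand G h z $ k) contour_integrable_on \<gamma> \<and>
      (\<chi> k. Re (F k (pathfinish \<gamma>) - F k z0)) $ k = Re (contour_integral \<gamma> (\<lambda>z. weierstrass_integrand G h z $ k))"
    using g by (auto simp: contour_integrable_on_def contour_integral_unique)
qed

text \<open>The first two components are combinations of exponentials with the frequencies \<open>2 a + B\<close> and
  \<open>2 a - B\<close>, the third has the frequency \<open>2 a\<close>; the factor \<open>exp z\<close> in
  the height differential has been absorbed into \<open>exp (2 a z)\<close>.\<close>

lemma twist_integrand:
  assumes "A \<noteq> 0"
  shows "weierstrass_integrand (twist_gauss A B) (twist_height a B) z $ 1
      = exp (2 * of_real a * z) / (4 * of_real B) * (exp (of_real B * z) / of_real A - of_real A * exp (- of_real B * z))"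
    "weierstrass_integrand (twist_gauss A B) (twist_height a B) z $ 2
      = - \<i> * exp (2 * of_real a * z) / (4 * of_real B) * (exp (of_real B * z) / of_real A + of_real A * exp (- of_real B * z))"
    "weierstrass_integrand (twist_gauss A B) (twist_height a B) z $ 3
      = exp (2 * of_real a * z) / (2 * of_real B)"
proof -
  have h: "twist_height a B z = exp (2 * of_real a * z) / (2 * of_real B)"
    by (simp add: twist_height_def cover_pow_def algebra_simps flip: exp_add)
  have g: "1 / twist_gauss A B z = - of_real A * exp (- of_real B * z)"
    using assms by (simp add: twist_gauss_def cover_pow_def exp_minus field_simps)
  have g': "twist_gauss A B z = - exp (of_real B * z) / of_real A"
    by (simp add: twist_gauss_def cover_pow_def)
  show "weierstrass_integrand (twist_gauss A B) (twist_height a B) z $ 1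
      = exp (2 * of_real a * z) / (4 * of_real B) * (exp (of_real B * z) / of_real A - of_real A * exp (- of_real B * z))"
    "weierstrass_integrand (twist_gauss A B) (twist_height a B) z $ 2
      = - \<i> * exp (2 * of_real a * z) / (4 * of_real B) * (exp (of_real B * z) / of_real A + of_real A * exp (- of_real B * z))"
    "weierstrass_integrand (twist_gauss A B) (twist_height a B) z $ 3
      = exp (2 * of_real a * z) / (2 * of_real B)"
    unfolding weierstrass_integrand_def vector_3 g h unfolding g'
    by (simp_all add: algebra_simps add_divide_distrib)
qed

text \<open>Matching the normal form of a null curve with the Weierstrass integrand: the exponent \<open>B\<close> must be \<open>k\<close>,
  the coefficient of \<open>e3\<close> determines the translation \<open>t\<close>, the one of \<open>exp (k z)\<close> then determines
  \<open>A\<close>, and the one of \<open>exp (- k z)\<close> agrees with no further choice.\<close>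

lemma exponential_curve_weierstrass:
  fixes e1 e2 e3 :: "real^3" and z :: complex
  assumes pos: "s > 0" "k > 0" "v > 0" and t: "exp (2 * a * t) = 2 * s"
  defines "A \<equiv> s * exp (k * t) / (2 * k * v)"
  shows "exp (2 * of_real a * z) * (of_real (s / k * e3 $ j)
       + of_real v * exp (of_real k * z) * (of_real (e1 $ j) - \<i> * of_real (e2 $ j))
       - of_real (s\<^sup>2 / (4 * k\<^sup>2 * v)) * exp (- of_real k * z) * (of_real (e1 $ j) + \<i> * of_real (e2 $ j)))
    = of_real (e1 $ j) * weierstrass_integrand (twist_gauss A k) (twist_height a k) (z + of_real t) $ 1
    + of_real (e2 $ j) * weierstrass_integrand (twist_gauss A k) (twist_height a k) (z + of_real t) $ 2
    + of_real (e3 $ j) * weierstrass_integrand (twist_gauss A k) (twist_height a k) (z + of_real t) $ 3"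
proof -
  have A: "A > 0" using pos by (simp add: A_def)
  have h: "exp (2 * of_real a * (z + of_real t)) = exp (2 * of_real a * z) * (2 * of_real s)"
  proof -
    have "exp (2 * of_real a * (z + of_real t)) = exp (2 * of_real a * z) * of_real (exp (2 * a * t))"
      by (simp add: distrib_left exp_add flip: exp_of_real)
    then show ?thesis by (simp add: t)
  qed
  have p: "exp (of_real k * (z + of_real t)) / of_real A = exp (of_real k * z) * of_real (2 * k * v / s)"
  proof -
    have "exp (of_real k * (z + of_real t)) = exp (of_real k * z) * of_real (exp (k * t))"
      by (simp add: distrib_left exp_add flip: exp_of_real)
    moreover have "exp (k * t) / A = 2 * k * v / s" using pos by (simp add: A_def field_simps)
    ultimately show ?thesis by (metis times_divide_eq_right of_real_divide)
  qed
  have m: "of_real A * exp (- of_real k * (z + of_real t)) = exp (- of_real k * z) * of_real (s / (2 * k * v))"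
  proof -
    have "exp (- of_real k * (z + of_real t)) = exp (- of_real k * z) * of_real (exp (- (k * t)))"
      by (simp add: distrib_left exp_add exp_diff exp_minus divide_inverse flip: exp_of_real)
    moreover have "A * exp (- (k * t)) = s / (2 * k * v)" using pos by (simp add: A_def exp_minus field_simps)
    ultimately show ?thesis by (metis mult.left_commute of_real_mult)
  qed
  have "A \<noteq> 0" using A by simp
  show ?thesis
    unfolding twist_integrand[OF \<open>A \<noteq> 0\<close>] h p m
    using pos by (simp add: field_simps power2_eq_square)
qed

lemma orthonormal_combination_isometry:
  fixes e1 e2 e3 c :: "real^3"
  assumes "norm e1 = 1" "norm e2 = 1" "norm e3 = 1" "e1 \<bullet> e2 = 0" "e1 \<bullet> e3 = 0" "e2 \<bullet> e3 = 0"
  shows "euclidean_isometry (\<lambda>y. (y $ 1) *\<^sub>R e1 + (y $ 2) *\<^sub>R e2 + (y $ 3) *\<^sub>R e3 + c)"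
  unfolding euclidean_isometry_def
proof (intro allI)
  fix x y :: "real^3"
  define d where "d = x - y"
  have "(norm ((d $ 1) *\<^sub>R e1 + (d $ 2) *\<^sub>R e2 + (d $ 3) *\<^sub>R e3))\<^sup>2 = (norm d)\<^sup>2"
    using assms unfolding power2_norm_eq_inner norm_eq_1
    by (simp add: inner_add_left inner_add_right inner_commute[of e2 e1] inner_commute[of e3 e1] inner_commute[of e3 e2]
        inner_vec_def[of d] sum_3)
  then have "norm ((d $ 1) *\<^sub>R e1 + (d $ 2) *\<^sub>R e2 + (d $ 3) *\<^sub>R e3) = norm d" by simp
  then show "dist ((x $ 1) *\<^sub>R e1 + (x $ 2) *\<^sub>R e2 + (x $ 3) *\<^sub>R e3 + c) ((y $ 1) *\<^sub>R e1 + (y $ 2) *\<^sub>R e2 + (y $ 3) *\<^sub>R e3 + c) = dist x y"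
    unfolding dist_norm d_def by (simp add: algebra_simps)
qed


section \<open>Classification\<close>

theorem theorem1p5:
  fixes f :: "real^2 \<Rightarrow> real^3"
    and u1 u2 :: ereal
    and l1 l2 :: "real \<Rightarrow> real"
    and a :: real
  assumes "u1 < u2"
    and "intrinsic_surface_of_revolution u1 u2 f"
    and "0 < a"
    and "has_twist u1 u2 f (\<lambda>v. a * v) l1 l2"
    and minimal: "\<forall>u. u1 < ereal u \<and> ereal u < u2 \<longrightarrow> l1 u + l2 u = 0"
    and nonplanar: "\<not> coplanar (f ` strip u1 u2)"
  shows "\<exists>A B :: real. A > 0 \<and> B > 0 \<and>
    (\<exists>(r1::real) (r2::ereal). 0 \<le> r1 \<and> ereal r1 < r2 \<and>
      (\<exists>X \<phi> T.
         weierstrass_surface_on (annulus_cover r1 r2) (twist_gauss A B) (twist_height a B) X \<and>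
         conformal_bijection (to_complex ` strip u1 u2) (annulus_cover r1 r2) \<phi> \<and>
         euclidean_isometry T \<and>
         (\<forall>x\<in>strip u1 u2. f x = T (X (\<phi> (to_complex x))))))"
proof -
  let ?S = "strip u1 u2"
  define Z where "Z = to_complex ` ?S"
  note S = strip_open_convex[of u1 u2]
  note Z = to_complex_strip_open_convex[of u1 u2, folded Z_def]
  have Z_iff: "z \<in> Z \<longleftrightarrow> u1 < ereal (Re z) \<and> ereal (Re z) < u2" for z
    unfolding Z_def to_complex_strip by simp
  have q: "of_cplx z \<in> ?S" if "z \<in> Z" for z
    using that by (simp add: Z_iff strip_def)
  obtain s0 where "u1 < ereal s0" "ereal s0 < u2" using assms(1) ereal_dense2 by blast
  then have z0: "complex_of_real s0 \<in> Z" by (simp add: Z_iff)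
  obtain \<rho> where pos: "\<And>u. u1 < ereal u \<Longrightarrow> ereal u < u2 \<Longrightarrow> \<rho> u > 0"
    and pos': "\<forall>u. u1 < ereal u \<and> ereal u < u2 \<longrightarrow> \<rho> u > 0"
    and I: "\<forall>x\<in>?S. \<forall>X Y. first_fundamental_form f x X Y = (\<rho> (x $ 1))\<^sup>2 * (X \<bullet> Y)"
    and f: "C_k_on 3 f ?S"
    using assms(2) unfolding intrinsic_surface_of_revolution_def C3_immersion_on_def by blast
  have min: "l1 u + l2 u = 0" if "u1 < ereal u" "ereal u < u2" for u using minimal that by blast
  define fu fv where "fu = partial 1 f" and "fv = partial 2 f"
  define fuu fuv where "fuu = partial 1 fu" and "fuv = partial 2 fu"
  note D = twisted_minimal_surface_derivatives[OF f I pos' assms(4) minimal,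
      folded fu_def fv_def, folded fuu_def fuv_def]
  define g where "g x = ((\<rho> x)\<^sup>2 * l1 x)\<^sup>2" for x
  \<comment> \<open>\<open>\<Phi> = f\<^sub>u - \<i> f\<^sub>v\<close> and its complex derivative.\<close>
  define \<Phi> where "\<Phi> j z = Complex (fu (of_cplx z) $ j) ((- fv (of_cplx z)) $ j)" for j z
  define \<Phi>' where "\<Phi>' j z = Complex (fuu (of_cplx z) $ j) ((- fuv (of_cplx z)) $ j)" for j z
  have \<Phi>d: "(\<Phi> j has_field_derivative \<Phi>' j z) (at z)" if z: "z \<in> Z" for j z
  proof -
    let ?x = "of_cplx z"
    note d = D(6,7,11,12)[OF q[OF z]]
    have pu: "partial i fu ?x = (if i = 1 then fuu ?x else fuv ?x)" "partial i fv ?x = (if i = 1 then fuv ?x else - fuu ?x)" for i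
      using d exhaust_2[of i] by (auto simp: fuu_def fuv_def)
    have "((\<lambda>w. Complex (1 * fu (of_cplx w) $ j) ((-1) * fv (of_cplx w) $ j)) has_field_derivative
        Complex (partial 1 (\<lambda>y. 1 * fu y $ j) ?x) (partial 1 (\<lambda>y. (-1) * fv y $ j) ?x)) (at z)"
      by (rule cauchy_riemann_has_field_derivative)
        (use partial_component[OF d(3)] partial_component[OF d(4)] pu in \<open>simp_all only:, simp_all\<close>)
    then show ?thesis
      unfolding partial_component(2)[OF d(3)] partial_component(2)[OF d(4)]
      by (simp add: pu \<Phi>_def[abs_def] \<Phi>'_def)
  qed
  \<comment> \<open>The twist gives \<open>\<Phi>' \<cdot> \<Phi>'\<close> the phase of \<open>exp (4 a z)\<close>. Dividing \<open>\<Phi>\<close> by \<open>exp (2 a z)\<close> removes it.\<close>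
  define c where "c z = exp (- 2 * of_real a * z)" for z :: complex
  define P where "P j z = c z * \<Phi> j z" for j z
  have Pd: "(P j has_field_derivative c z * (\<Phi>' j z - 2 * of_real a * \<Phi> j z)) (at z)" if "z \<in> Z" for j z
    unfolding P_def[abs_def] c_def
    by (auto intro!: derivative_eq_intros \<Phi>d[OF that] simp: algebra_simps)
  have hol: "P j holomorphic_on Z" for j
    unfolding holomorphic_on_open[OF Z(1)] using Pd by blast
  have \<Phi>\<Phi>: "bil (\<lambda>j. \<Phi> j z) (\<lambda>j. \<Phi> j z) = 0" "bil (\<lambda>j. \<Phi> j z) (\<lambda>j. \<Phi>' j z) = 0"
    "bil (\<lambda>j. \<Phi>' j z) (\<lambda>j. \<Phi>' j z) = of_real (g (Re z)) * exp (\<i> * of_real (4 * a * Im z))"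
    "herm (\<lambda>j. \<Phi> j z) (\<lambda>j. \<Phi> j z) = of_real (2 * (\<rho> (Re z))\<^sup>2)" if z: "z \<in> Z" for z
    unfolding \<Phi>_def \<Phi>'_def bil_Complex herm_Complex
    using D(1-5)[OF q[OF z]] D(8,9)[OF q[OF z]]
    by (simp_all add: complex_eq_iff g_def inner_commute Re_exp Im_exp)
  have null: "bil (\<lambda>j. P j z) (\<lambda>j. P j z) = 0" if "z \<in> Z" for z
    using \<Phi>\<Phi>[OF that] by (simp add: P_def bil_linear)
  have cc: "c z * c z * exp (\<i> * of_real (4 * a * Im z)) = of_real (exp (- 4 * a * Re z))"
    "c z * cnj (c z) = of_real (exp (- 4 * a * Re z))" for z
  proof -
    have "- 2 * of_real a * z + - 2 * of_real a * z + \<i> * of_real (4 * a * Im z) = of_real (- 4 * a * Re z)"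
      by (simp add: complex_eq_iff)
    then show "c z * c z * exp (\<i> * of_real (4 * a * Im z)) = of_real (exp (- 4 * a * Re z))"
      unfolding c_def exp_add[symmetric] exp_of_real[symmetric] by (simp only:)
    have "- 2 * of_real a * z + cnj (- 2 * of_real a * z) = of_real (- 4 * a * Re z)"
      by (simp add: complex_eq_iff)
    then show "c z * cnj (c z) = of_real (exp (- 4 * a * Re z))"
      unfolding c_def exp_cnj exp_add[symmetric] exp_of_real[symmetric] by (simp only:)
  qed
  have speed: "bil (\<lambda>j. deriv (P j) z) (\<lambda>j. deriv (P j) z) = of_real (g (Re z) * exp (- 4 * a * Re z))" if z: "z \<in> Z" for z
  proof -
    have "bil (\<lambda>j. deriv (P j) z) (\<lambda>j. deriv (P j) z)
        = c z * c z * bil (\<lambda>j. \<Phi>' j z) (\<lambda>j. \<Phi>' j z)"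
      unfolding DERIV_imp_deriv[OF Pd[OF z]] bil_linear using \<Phi>\<Phi>(1,2)[OF z] bil_commute[of "\<lambda>j. \<Phi>' j z" "\<lambda>j. \<Phi> j z"]
      by simp
    also have "\<dots> = of_real (g (Re z)) * (c z * c z * exp (\<i> * of_real (4 * a * Im z)))"
      unfolding \<Phi>\<Phi>(3)[OF z] by (simp only: mult_ac)
    finally show ?thesis unfolding cc by simp
  qed
  have inv: "herm (\<lambda>j. P j z) (\<lambda>j. P j z) = herm (\<lambda>j. P j w) (\<lambda>j. P j w)"
    if "z \<in> Z" "w \<in> Z" "Re z = Re w" for z w
  proof -
    have "herm (\<lambda>j. P j z) (\<lambda>j. P j z) = (c z * cnj (c z)) * of_real (2 * (\<rho> (Re z))\<^sup>2)" if "z \<in> Z" for z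
      unfolding P_def herm_linear \<Phi>\<Phi>(4)[OF that] by (simp only: mult_ac)
    with that show ?thesis unfolding cc by simp
  qed
  \<comment> \<open>Being holomorphic and real, \<open>P' \<cdot> P'\<close> is constant; this replaces the Codazzi equations.\<close>
  have "\<exists>C. \<forall>z\<in>Z. bil (\<lambda>j. deriv (P j) z) (\<lambda>j. deriv (P j) z) = C"
  proof (rule real_valued_holomorphic_constant)
    show "(\<lambda>z. bil (\<lambda>j. deriv (P j) z) (\<lambda>j. deriv (P j) z)) holomorphic_on Z"
      unfolding bil_def by (intro holomorphic_intros holomorphic_deriv hol Z(1))
  qed (use Z speed convex_connected in auto)
  then obtain C' where "\<And>z. z \<in> Z \<Longrightarrow> bil (\<lambda>j. deriv (P j) z) (\<lambda>j. deriv (P j) z) = C'" by blast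
  define C where "C = g s0 * exp (- 4 * a * s0)"
  have C: "g (Re z) * exp (- 4 * a * Re z) = C" if "z \<in> Z" for z
  proof -
    have "complex_of_real (g (Re z) * exp (- 4 * a * Re z)) = of_real C"
      using \<open>\<And>z. z \<in> Z \<Longrightarrow> _ = C'\<close>[OF that] \<open>\<And>z. z \<in> Z \<Longrightarrow> _ = C'\<close>[OF z0] speed[OF that] speed[OF z0]
      by (simp add: C_def)
    then show ?thesis using of_real_eq_iff by blast
  qed
  have "C \<noteq> 0"
  proof
    assume "C = 0"
    have l0: "l1 (y $ 1) = 0" if y: "y \<in> ?S" for y :: "real^2"
    proof -
      have "to_complex y \<in> Z" using y by (simp add: Z_def)
      from C[OF this] have "g (y $ 1) = 0" using \<open>C = 0\<close> by (simp add: to_complex_def)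
      moreover have "\<rho> (y $ 1) > 0" using pos y by (simp add: strip_def)
      ultimately show ?thesis by (simp add: g_def)
    qed
    have "coplanar (f ` ?S)"
    proof (rule zero_shape_operator_imp_coplanar[OF S _ f, where r = "\<lambda>y::real^2. (\<rho> (y $ 1))\<^sup>2"])
      show "?S \<noteq> {}" using z0 unfolding Z_def by blast
      fix y assume y: "y \<in> ?S"
      show "partial 1 f y \<bullet> partial 1 f y = (\<rho> (y $ 1))\<^sup>2" "partial 2 f y \<bullet> partial 2 f y = (\<rho> (y $ 1))\<^sup>2"
        "partial 1 f y \<bullet> partial 2 f y = 0"
        using D(1-3)[OF y] by (simp_all add: fu_def fv_def)
      have "u1 < ereal (y $ 1)" "ereal (y $ 1) < u2" using y by (simp_all add: strip_def)
      then have "0 < \<rho> (y $ 1)" by (rule pos)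
      then show "0 < (\<rho> (y $ 1))\<^sup>2" by simp
      have "l2 (y $ 1) = 0" using l0[OF y] min[of "y $ 1"] y by (simp add: strip_def)
      then show "matrix (shape_operator f y) = 0"
        using assms(4) y l0[OF y]
        by (simp add: has_twist_def diag2_def vec_eq_iff matrix_matrix_mult_def sum_2 forall_2 vector_2)
    qed
    with nonplanar show False by blast
  qed
  moreover have "C \<ge> 0" by (simp add: C_def g_def)
  ultimately have Cpos: "C > 0" by simp
  have speedC: "bil (\<lambda>j. deriv (P j) z) (\<lambda>j. deriv (P j) z) = of_real C" if "z \<in> Z" for z
    using speed[OF that] unfolding C[OF that] .
  have "Z \<noteq> {}" using z0 by blast
  obtain e1 e2 e3 :: "real^3" and k v :: real where
    e: "norm e1 = 1" "norm e2 = 1" "norm e3 = 1" "e1 \<bullet> e2 = 0" "e1 \<bullet> e3 = 0" "e2 \<bullet> e3 = 0" and k: "k > 0" and v: "v > 0"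
    and Peq: "\<And>j z. z \<in> Z \<Longrightarrow> P j z = of_real (sqrt C / k * e3 $ j)
       + of_real v * exp (of_real k * z) * (of_real (e1 $ j) - \<i> * of_real (e2 $ j))
       - of_real (C / (4 * k\<^sup>2 * v)) * exp (- of_real k * z) * (of_real (e1 $ j) + \<i> * of_real (e2 $ j))"
    by (rule null_curve_exponential_form[OF Z(1,2) \<open>Z \<noteq> {}\<close> Cpos hol null speedC inv])
      (assumption | (rule that; (assumption | blast)))+
  define s where "s = sqrt C"
  have s: "s > 0" "C = s\<^sup>2" using Cpos by (simp_all add: s_def)
  \<comment> \<open>The constants are those required by \<open>exponential_curve_weierstrass\<close>.\<close>
  define t where "t = ln (2 * s) / (2 * a)"
  have t: "exp (2 * a * t) = 2 * s" using assms(3) s by (simp add: t_def)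
  define A where "A = s * exp (k * t) / (2 * k * v)"
  have A: "A > 0" using s k v by (simp add: A_def)
  define J where "J m z = weierstrass_integrand (twist_gauss A k) (twist_height a k) z $ m" for m z
  have match: "\<Phi> j z = of_real (e1 $ j) * J 1 (z + of_real t) + of_real (e2 $ j) * J 2 (z + of_real t)
      + of_real (e3 $ j) * J 3 (z + of_real t)" if "z \<in> Z" for j z
  proof -
    have "exp (2 * of_real a * z) * c z = 1" by (simp add: c_def flip: exp_add)
    then have "\<Phi> j z = exp (2 * of_real a * z) * P j z" by (simp add: P_def flip: mult.assoc)
    also have "\<dots> = of_real (e1 $ j) * J 1 (z + of_real t) + of_real (e2 $ j) * J 2 (z + of_real t)
      + of_real (e3 $ j) * J 3 (z + of_real t)"
      using exponential_curve_weierstrass[OF s(1) k v t, of z e3 j e1 e2]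
      unfolding Peq[OF that] J_def s_def[symmetric] A_def s(2)[symmetric] .
    finally show ?thesis .
  qed
  obtain r1 r2 where r: "0 \<le> r1" "ereal r1 < r2"
    and E: "annulus_cover r1 r2 = {z. u1 < ereal (Re z - t) \<and> ereal (Re z - t) < u2}"
    using translated_strip_annulus_cover[OF assms(1)] by metis
  define E where "E = annulus_cover r1 r2"
  have E_iff: "z \<in> E \<longleftrightarrow> z - of_real t \<in> Z" for z
    by (simp add: E_def E Z_iff)
  have EZ: "E = (\<lambda>z. of_real t + z) ` Z"
  proof -
    have "z \<in> (\<lambda>z. of_real t + z) ` Z" if "z \<in> E" for z
      by (rule image_eqI[of _ _ "z - of_real t"]) (use that E_iff in auto)
    then show ?thesis by (auto simp: E_iff)
  qed
  have Eoc: "open E" "convex E" unfolding EZ using Z open_translation convex_translation by blast+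
  have J_eq: "J 1 = (\<lambda>z. exp (2 * of_real a * z) / (4 * of_real k) * (exp (of_real k * z) / of_real A - of_real A * exp (- of_real k * z)))"
      "J 2 = (\<lambda>z. - \<i> * exp (2 * of_real a * z) / (4 * of_real k) * (exp (of_real k * z) / of_real A + of_real A * exp (- of_real k * z)))"
      "J 3 = (\<lambda>z. exp (2 * of_real a * z) / (2 * of_real k))"
    using A unfolding J_def by (auto simp only: twist_integrand)
  have Jhol: "J m holomorphic_on E" for m
  proof -
    have "J 1 holomorphic_on E" "J 2 holomorphic_on E" "J 3 holomorphic_on E"
      unfolding J_eq using A k by (auto intro!: holomorphic_intros)
    then show ?thesis using exhaust_3[of m] by auto
  qed
  have "\<exists>F. \<forall>z\<in>E. (F has_field_derivative J m z) (at z)" for m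
    using holomorphic_convex_primitive'[OF Eoc(2,1) Jhol[of m]] at_within_open[OF _ Eoc(1)] by metis
  then obtain F where F: "\<And>m z. z \<in> E \<Longrightarrow> (F m has_field_derivative J m z) (at z)" by metis
  \<comment> \<open>Any base point would do; changing it translates the surface.\<close>
  define \<zeta>0 where "\<zeta>0 = complex_of_real (s0 + t)"
  have "\<zeta>0 \<in> E" using z0 by (simp add: E_iff \<zeta>0_def)
  define X where "X = (\<lambda>z. (\<chi> m. Re (F m z - F m \<zeta>0)) :: real^3)"
  have WX: "weierstrass_surface_on E (twist_gauss A k) (twist_height a k) X"
    unfolding X_def by (rule weierstrass_surface_from_primitive[OF \<open>\<zeta>0 \<in> E\<close>]) (use F in \<open>simp add: J_def\<close>)
  define \<phi> where "\<phi> z = z + complex_of_real t" for z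
  have \<phi>E: "\<phi> z \<in> E" if "z \<in> Z" for z using that by (simp add: \<phi>_def E_iff)
  have conf: "conformal_bijection Z E \<phi>"
    unfolding conformal_bijection_def
  proof
    show "\<phi> holomorphic_on Z" unfolding \<phi>_def by (intro holomorphic_intros)
    show "bij_betw \<phi> Z E"
      unfolding bij_betw_def EZ \<phi>_def by (auto simp: inj_on_def add.commute)
  qed
  define Y where "Y y = (y $ 1) *\<^sub>R e1 + (y $ 2) *\<^sub>R e2 + (y $ 3) *\<^sub>R e3" for y :: "real^3"
  \<comment> \<open>Both surfaces are real parts of primitives of \<open>\<Phi>\<close>, so they differ by a translation.\<close>
  have "\<exists>d. \<forall>x\<in>?S. f x - Y (X (\<phi> (to_complex x))) = d"
  proof (rule has_derivative_zero_constant[OF S(2)])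
    fix x assume x: "x \<in> ?S"
    define z where "z = to_complex x"
    have z: "z \<in> Z" "of_cplx z = x" using x by (simp_all add: z_def Z_def)
    have fd: "(f has_derivative (\<lambda>h. (h $ 1) *\<^sub>R fu x + (h $ 2) *\<^sub>R fv x)) (at x)"
      unfolding fu_def fv_def by (rule has_derivative_partial[OF D(10)[OF x]])
    have td: "((\<lambda>x. \<phi> (to_complex x)) has_derivative to_complex) (at x)"
      unfolding \<phi>_def using linear_imp_has_derivative[OF linear_to_complex, of "at x"]
      by (auto intro!: derivative_eq_intros)
    have Xd: "((\<lambda>x. X (\<phi> (to_complex x)) $ m) has_derivative (\<lambda>h. Re (J m (\<phi> z) * to_complex h))) (at x)" for m
    proof -
      have "(F m has_derivative (\<lambda>h. J m (\<phi> z) * h)) (at (\<phi> (to_complex x)))"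
        using F[OF \<phi>E[OF z(1)]] by (simp add: has_field_derivative_def z_def)
      from has_derivative_compose[OF td this]
      have "((\<lambda>x. F m (\<phi> (to_complex x)) - F m \<zeta>0) has_derivative (\<lambda>h. J m (\<phi> z) * to_complex h)) (at x)"
        by (auto intro!: derivative_eq_intros)
      then have "((\<lambda>x. Re (F m (\<phi> (to_complex x)) - F m \<zeta>0)) has_derivative (\<lambda>h. Re (J m (\<phi> z) * to_complex h))) (at x)"
        by (rule bounded_linear.has_derivative[OF bounded_linear_Re])
      then show ?thesis by (simp add: X_def)
    qed
    have "((\<lambda>x. f x - Y (X (\<phi> (to_complex x)))) has_derivative
      (\<lambda>h. ((h $ 1) *\<^sub>R fu x + (h $ 2) *\<^sub>R fv x) - (Re (J 1 (\<phi> z) * to_complex h) *\<^sub>R e1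
         + Re (J 2 (\<phi> z) * to_complex h) *\<^sub>R e2 + Re (J 3 (\<phi> z) * to_complex h) *\<^sub>R e3))) (at x)"
      unfolding Y_def
      by (intro has_derivative_diff fd has_derivative_add has_derivative_scaleR_left Xd)
    moreover have "((h $ 1) *\<^sub>R fu x + (h $ 2) *\<^sub>R fv x) - (Re (J 1 (\<phi> z) * to_complex h) *\<^sub>R e1
         + Re (J 2 (\<phi> z) * to_complex h) *\<^sub>R e2 + Re (J 3 (\<phi> z) * to_complex h) *\<^sub>R e3) = 0" for h
    proof -
      have "h $ 1 * fu x $ j + h $ 2 * fv x $ j = Re (\<Phi> j z * to_complex h)" for j
        by (simp add: \<Phi>_def z to_complex_def mult_ac)
      then show ?thesis
        unfolding match[OF z(1)] by (simp add: vec_eq_iff \<phi>_def algebra_simps)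
    qed
    ultimately show "((\<lambda>x. f x - Y (X (\<phi> (to_complex x)))) has_derivative (\<lambda>h. 0)) (at x within ?S)"
      by (simp add: has_derivative_at_withinI)
  qed
  then obtain d where d: "\<And>x. x \<in> ?S \<Longrightarrow> f x - Y (X (\<phi> (to_complex x))) = d" by blast
  have iso: "euclidean_isometry (\<lambda>y. Y y + d)"
    unfolding Y_def by (rule orthonormal_combination_isometry[OF e])
  have fT: "\<forall>x\<in>?S. f x = Y (X (\<phi> (to_complex x))) + d"
    using d by (metis add.commute diff_add_cancel)
  have "\<exists>X \<phi> T. weierstrass_surface_on (annulus_cover r1 r2) (twist_gauss A k) (twist_height a k) X \<and>
         conformal_bijection (to_complex ` ?S) (annulus_cover r1 r2) \<phi> \<and> euclidean_isometry T \<and>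
         (\<forall>x\<in>?S. f x = T (X (\<phi> (to_complex x))))"
    by (rule exI[of _ X], rule exI[of _ \<phi>], rule exI[of _ "\<lambda>y. Y y + d"])
      (use WX conf iso fT in \<open>simp add: E_def Z_def\<close>)
  with A k r show ?thesis by blast
qed

end
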